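(* There exist constants $c>0$ and $n_0$ such that for every integer $n\ge n_0$ there is a graph $G$ on $n$ vertices for which the ratio between the degeneracy $\mathrm{dg}(G)$ and the spectral degeneracy $\mathrm{sd}(G)$ satisfies $$\frac{\mathrm{dg}(G)}{\mathrm{sd}(G)}\ \ge\ c\,\frac{\log\log n}{\log\log\log n}\qquad\text{and}\qquad \frac{\mathrm{dg}(G)}{\mathrm{sd}(G)}\ \ge\ c\,\frac{\log\log \Delta(G)}{\log\log\log \Delta(G)},$$ where $\Delta(G)$ is large enough for the iterated logarithms to be defined and positive.
   Context: All graphs are finite and simple. $\Delta(G)$ is the maximum degree of $G$; $\rho(G)$ is the spectral radius of $G$, i.e. the largest eigenvalue of its adjacency matrix; $\log$ is the natural logarithm. A graph is $k$-degenerate if every (nonempty) subgraph of it has a vertex of degree at most $k$; the degeneracy $\mathrm{dg}(G)$ is the least $k$ such that $G$ is $k$-degenerate. A graph $G$ is spectrally $d$-degenerate if every subgraph $H\subseteq G$ satisfies $\rho(H)\le\sqrt{d\,\Delta(H)}$; the spectral degeneracy $\mathrm{sd}(G)$ is the least real $d\ge 0$ such that $G$ is spectrally $d$-degenerate. *)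

theory Defs
  imports
    Complex_Main
    "Graph_Theory.Pair_Digraph"
    "Graph_Theory.Digraph_Component"
    "Jordan_Normal_Form.Spectral_Radius"
begin

text \<open>
  A finite simple graph is a \<^locale>\<open>pair_graph\<close>: finitely many vertices, and a symmetric, loop-free
  set of ordered pairs as edges. The degree of a vertex is its out-degree.
  The empty graph satisfies \<^locale>\<open>pair_graph\<close>; \<open>max_degree\<close> and \<open>graph_spectral_radius\<close> are
  meaningful only for nonempty graphs.
\<close>

definition max_degree :: "'a pair_pre_digraph \<Rightarrow> nat" where
  "max_degree G = Max (out_degree (with_proj G) ` pverts G)"

text \<open>
  The subgraphs are not necessarily induced, but they have to be simple graphs themselves, that is,
  they contain both orientations of each of their edges.
\<close>

definition nonempty_subgraph :: "'a pair_pre_digraph \<Rightarrow> 'a pair_pre_digraph \<Rightarrow> bool" where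
  "nonempty_subgraph H G \<longleftrightarrow> pair_graph H \<and> subgraph (with_proj H) (with_proj G) \<and> pverts H \<noteq> {}"

definition k_degenerate :: "nat \<Rightarrow> 'a pair_pre_digraph \<Rightarrow> bool" where
  "k_degenerate k G \<longleftrightarrow>
     (\<forall>H. nonempty_subgraph H G \<longrightarrow> (\<exists>v \<in> pverts H. out_degree (with_proj H) v \<le> k))"

definition degeneracy :: "'a pair_pre_digraph \<Rightarrow> nat" where
  "degeneracy G = (LEAST k. k_degenerate k G)"

text \<open>
  Rows and columns follow the increasing enumeration of the vertices; the eigenvalues do not
  depend on this choice.
\<close>

definition adjacency_matrix :: "'a::linorder pair_pre_digraph \<Rightarrow> real mat" where
  "adjacency_matrix G =
     (let vs = sorted_list_of_set (pverts G) in
        mat (length vs) (length vs) (\<lambda>(i, j). of_bool ((vs ! i, vs ! j) \<in> parcs G)))"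

definition graph_spectral_radius :: "'a::linorder pair_pre_digraph \<Rightarrow> real" where
  "graph_spectral_radius G = Max (spectrum (adjacency_matrix G))"

definition spectrally_degenerate :: "real \<Rightarrow> 'a::linorder pair_pre_digraph \<Rightarrow> bool" where
  "spectrally_degenerate d G \<longleftrightarrow>
     (\<forall>H. nonempty_subgraph H G \<longrightarrow> graph_spectral_radius H \<le> sqrt (d * real (max_degree H)))"

definition spectral_degeneracy :: "'a::linorder pair_pre_digraph \<Rightarrow> real" where
  "spectral_degeneracy G = (LEAST d. 0 \<le> d \<and> spectrally_degenerate d G)"

end

theory Submission
  imports Defs "HOL-Analysis.Elementary_Metric_Spaces" "HOL-Library.FuncSet"
begin

text \<open>
  Let a random \<open>f\<close> join each of \<open>N\<close> left vertices to one vertex in each of \<open>M\<close> layers, where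
  the vertices of layer \<open>i\<close> have degree about \<open>d i = 2 ^ (10 * M * 4 ^ i)\<close>. The average degree
  of this graph is at least \<open>M\<close>, whereas the spectral degeneracy is bounded by a constant: in a
  subgraph of maximum degree \<open>D\<close>, the layers with \<open>d i \<le> D\<close> are star forests of geometrically
  growing degrees, which contribute \<open>O(sqrt D)\<close> altogether; the next layer is a star forest of
  degree at most \<open>D\<close>; and on the remaining layers the subgraph is so sparse a part of the random
  graph that it is 8-degenerate, which again yields \<open>O(sqrt D)\<close>.
\<close>

section \<open>Spectral radius and quadratic form\<close>

text \<open>The obstacle is the number of layers above the threshold: bounding each of them by
  \<open>sqrt D\<close> separately would cost a factor of order \<open>M\<close>, the very quantity
  to be gained. Treating them together requires sparsity, and its price fixes the parameters. Dense
  vertex sets are excluded by a union bound that succeeds only if \<open>d m\<close> exceeds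
  \<open>d (m - 1) ^ 3\<close> times a factor depending on \<open>M\<close> alone. Hence each degree
  is the fourth power of the preceding one, \<open>N\<close> is doubly exponential in
  \<open>M\<close>, and \<open>M\<close> can be of order \<open>ln (ln n)\<close>. As the spectral
  degeneracy stays at most 144, the ratio is then at least a constant times
  \<open>ln (ln n)\<close>.\<close>

lemma eigenvalue_mat_iff:
  fixes a :: "'v \<Rightarrow> 'v \<Rightarrow> 'b::field"
  assumes "distinct vs"
  shows "eigenvalue (mat (length vs) (length vs) (\<lambda>(i, j). a (vs ! i) (vs ! j))) k \<longleftrightarrow>
    (\<exists>y. (\<exists>u\<in>set vs. y u \<noteq> 0) \<and> (\<forall>u\<in>set vs. (\<Sum>v\<in>set vs. a u v * y v) = k * y u))"
    (is "eigenvalue ?A k \<longleftrightarrow> ?R")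
proof -
  let ?n = "length vs"
  have sum_vs: "(\<Sum>v\<in>set vs. g v) = (\<Sum>j<?n. g (vs ! j))" for g :: "'v \<Rightarrow> 'b"
    using assms by (intro sum.reindex_bij_betw[symmetric] bij_betw_nth) auto
  have mv: "(?A *\<^sub>v x) $ i = (\<Sum>j<?n. a (vs ! i) (vs ! j) * x $ j)"
    if "x \<in> carrier_vec ?n" "i < ?n" for x i
    using that by (simp add: scalar_prod_def lessThan_atLeast0)
  show ?thesis
  proof
    assume "eigenvalue ?A k"
    then obtain x where x: "x \<in> carrier_vec ?n" "x \<noteq> 0\<^sub>v ?n" "?A *\<^sub>v x = k \<cdot>\<^sub>v x"
      by (auto simp: eigenvalue_def eigenvector_def)
    define idx where "idx = the_inv_into {..<?n} ((!) vs)"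
    have inj: "inj_on ((!) vs) {..<?n}"
      using assms by (simp add: inj_on_nth)
    have idx: "idx (vs ! j) = j" if "j < ?n" for j
      unfolding idx_def using that by (intro the_inv_into_f_f[OF inj]) auto
    define y where "y v = x $ idx v" for v
    have y: "y (vs ! j) = x $ j" if "j < ?n" for j
      using idx[OF that] by (simp add: y_def)
    have "\<exists>j<?n. x $ j \<noteq> 0"
    proof (rule ccontr)
      assume "\<not> ?thesis"
      then have "x = 0\<^sub>v ?n" using x(1) by (intro eq_vecI) auto
      with x(2) show False by simp
    qed
    then obtain j where j: "j < ?n" "x $ j \<noteq> 0" by auto
    have "\<exists>u\<in>set vs. y u \<noteq> 0"
      using j y[OF j(1)] by (intro bexI[of _ "vs ! j"]) auto
    moreover have "(\<Sum>v\<in>set vs. a u v * y v) = k * y u" if u: "u \<in> set vs" for u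
    proof -
      from u obtain i where i: "i < ?n" "u = vs ! i" by (auto simp: in_set_conv_nth)
      have "(\<Sum>v\<in>set vs. a u v * y v) = (\<Sum>j<?n. a (vs ! i) (vs ! j) * x $ j)"
        unfolding sum_vs i(2) by (intro sum.cong) (auto simp: y)
      also have "\<dots> = (k \<cdot>\<^sub>v x) $ i"
        unfolding mv[OF x(1) i(1), symmetric] x(3) ..
      also have "\<dots> = k * y u" using x(1) i by (simp add: y)
      finally show ?thesis .
    qed
    ultimately show ?R by blast
  next
    assume ?R
    then obtain y u where y: "u \<in> set vs" "y u \<noteq> 0"
      "\<And>u. u \<in> set vs \<Longrightarrow> (\<Sum>v\<in>set vs. a u v * y v) = k * y u" by blast
    define x where "x = vec ?n (\<lambda>i. y (vs ! i))"
    have c: "x \<in> carrier_vec ?n" by (simp add: x_def)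
    from y(1) obtain i where "i < ?n" "u = vs ! i" by (auto simp: in_set_conv_nth)
    with y(2) have "x $ i \<noteq> 0\<^sub>v ?n $ i" by (simp add: x_def)
    then have "x \<noteq> 0\<^sub>v ?n" by metis
    moreover have "?A *\<^sub>v x = k \<cdot>\<^sub>v x"
    proof (rule eq_vecI)
      fix i assume "i < dim_vec (k \<cdot>\<^sub>v x)"
      then have i: "i < ?n" using c by simp
      show "(?A *\<^sub>v x) $ i = (k \<cdot>\<^sub>v x) $ i"
        unfolding mv[OF c i] using i y(3)[of "vs ! i"] by (simp add: x_def sum_vs)
    qed (use c in auto)
    ultimately show "eigenvalue ?A k"
      using c by (auto simp: eigenvalue_def eigenvector_def intro!: exI[of _ x])
  qed
qed

text \<open>The eigenvector is a function on the vertices, so that the enumeration behind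
  \<open>adjacency_matrix\<close> disappears from all later arguments.\<close>

definition adjacency_eigenvalue :: "'a pair_pre_digraph \<Rightarrow> real \<Rightarrow> ('a \<Rightarrow> real) \<Rightarrow> bool" where
  "adjacency_eigenvalue H k y \<longleftrightarrow> (\<exists>u\<in>pverts H. y u \<noteq> 0) \<and>
     (\<forall>u\<in>pverts H. (\<Sum>v\<in>pverts H. of_bool ((u, v) \<in> parcs H) * y v) = k * y u)"

lemma finite_spectrum_adjacency: "finite (spectrum (adjacency_matrix H))"
  unfolding adjacency_matrix_def Let_def by (rule card_finite_spectrum(1)[OF mat_carrier])

lemma spectrum_adjacency_iff:
  fixes H :: "'a::linorder pair_pre_digraph"
  assumes "finite (pverts H)"
  shows "k \<in> spectrum (adjacency_matrix H) \<longleftrightarrow> (\<exists>y. adjacency_eigenvalue H k y)"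
  using eigenvalue_mat_iff[of "sorted_list_of_set (pverts H)"
      "\<lambda>u v. of_bool ((u, v) \<in> parcs H)" k] assms
  by (simp add: spectrum_def adjacency_matrix_def Let_def adjacency_eigenvalue_def)

text \<open>A complex eigenvalue of a symmetric matrix is real, and the real or the imaginary part of
  its eigenvector is a real eigenvector.\<close>

lemma adjacency_eigenvalue_exists:
  fixes H :: "'a::linorder pair_pre_digraph"
  assumes fin: "finite (pverts H)" and ne: "pverts H \<noteq> {}"
    and sym: "\<And>u v. (u, v) \<in> parcs H \<Longrightarrow> (v, u) \<in> parcs H"
  shows "\<exists>k y. adjacency_eigenvalue H k y"
proof -
  let ?V = "pverts H"
  let ?vs = "sorted_list_of_set ?V"
  \<comment> \<open>The entries are complex because algebraic closedness is what guarantees a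
    nonempty spectrum.\<close>
  define a :: "'a \<Rightarrow> 'a \<Rightarrow> complex" where "a u v = of_bool ((u, v) \<in> parcs H)" for u v
  have a_sym: "a u v = a v u" for u v using sym by (auto simp: a_def)
  have a_cnj: "cnj (a u v) = a u v" for u v by (simp add: a_def)
  let ?A = "mat (length ?vs) (length ?vs) (\<lambda>(i, j). a (?vs ! i) (?vs ! j))"
  have "length ?vs > 0" using fin ne by (simp add: card_gt_0_iff)
  then have "spectrum ?A \<noteq> {}" by (intro spectrum_non_empty[of _ "length ?vs"]) auto
  then obtain k where "eigenvalue ?A k" by (auto simp: spectrum_def)
  then obtain y w where y: "w \<in> ?V" "y w \<noteq> 0"
    "\<And>u. u \<in> ?V \<Longrightarrow> (\<Sum>v\<in>?V. a u v * y v) = k * y u"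
    using eigenvalue_mat_iff[of ?vs a k] fin by auto
  \<comment> \<open>The Hermitian form at \<open>y\<close>, evaluated from either side, equals both
    \<open>k\<close> and \<open>cnj k\<close> times the squared norm of \<open>y\<close>.\<close>
  have "(\<Sum>u\<in>?V. cnj (y u) * (\<Sum>v\<in>?V. a u v * y v)) = k * (\<Sum>u\<in>?V. cnj (y u) * y u)"
    using y(3) by (simp add: sum_distrib_left mult_ac)
  moreover have "(\<Sum>u\<in>?V. cnj (y u) * (\<Sum>v\<in>?V. a u v * y v))
      = (\<Sum>v\<in>?V. y v * cnj (\<Sum>u\<in>?V. a v u * y u))"
    unfolding sum_distrib_left cnj_sum complex_cnj_mult a_cnj
    by (subst sum.swap) (auto intro!: sum.cong simp: a_sym mult_ac)
  moreover have "\<dots> = cnj k * (\<Sum>u\<in>?V. cnj (y u) * y u)"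
    using y(3) by (simp add: sum_distrib_left mult_ac del: cnj_sum)
  ultimately have "(k - cnj k) * (\<Sum>u\<in>?V. cnj (y u) * y u) = 0"
    by (simp add: algebra_simps)
  moreover have "(\<Sum>u\<in>?V. cnj (y u) * y u) = of_real (\<Sum>u\<in>?V. (cmod (y u))\<^sup>2)"
    unfolding of_real_sum complex_norm_square by (simp add: mult.commute)
  moreover have "(\<Sum>u\<in>?V. (cmod (y u))\<^sup>2) > 0"
    using y(1,2) fin by (intro sum_pos2[of _ w]) auto
  ultimately have "k = cnj k" by (metis mult_eq_0_iff of_real_eq_0_iff less_irrefl right_minus_eq)
  then have "Im k = 0" by (metis cnj.simps(2) equal_neg_zero)
  then have k: "k = of_real (Re k)" by (simp add: complex_eq_iff)
  have of_bool_parts: "Re (of_bool b) = of_bool b" "Im (of_bool b) = 0" for b by (cases b; simp)+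
  have re: "(\<Sum>v\<in>?V. of_bool ((u, v) \<in> parcs H) * Re (y v)) = Re k * Re (y u)" if "u \<in> ?V" for u
  proof -
    have "Re (\<Sum>v\<in>?V. a u v * y v) = Re (of_real (Re k) * y u)" using y(3)[OF that] k by simp
    then show ?thesis by (simp add: a_def of_bool_parts)
  qed
  have im: "(\<Sum>v\<in>?V. of_bool ((u, v) \<in> parcs H) * Im (y v)) = Re k * Im (y u)" if "u \<in> ?V" for u
  proof -
    have "Im (\<Sum>v\<in>?V. a u v * y v) = Im (of_real (Re k) * y u)" using y(3)[OF that] k by simp
    then show ?thesis by (simp add: a_def of_bool_parts)
  qed
  from y(2) consider "Re (y w) \<noteq> 0" | "Im (y w) \<noteq> 0" by (auto simp: complex_eq_iff)
  then show ?thesis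
  proof cases
    case 1
    then have "adjacency_eigenvalue H (Re k) (\<lambda>u. Re (y u))"
      using y(1) re by (auto simp: adjacency_eigenvalue_def)
    then show ?thesis by blast
  next
    case 2
    then have "adjacency_eigenvalue H (Re k) (\<lambda>u. Im (y u))"
      using y(1) im by (auto simp: adjacency_eigenvalue_def)
    then show ?thesis by blast
  qed
qed

lemma adjacency_eigenvalue_le:
  assumes fin: "finite (pverts H)"
    and "adjacency_eigenvalue H k y"
  shows "k \<le> graph_spectral_radius H"
  unfolding graph_spectral_radius_def
  using assms spectrum_adjacency_iff[OF fin] by (intro Max_ge finite_spectrum_adjacency) auto

text \<open>The spectrum is nonempty, so the radius is attained by a real eigenvector, and testing
  the form there suffices. Summing over \<open>parcs\<close> counts each undirected edge
  twice.\<close>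

lemma graph_spectral_radius_le:
  fixes H :: "'a::linorder pair_pre_digraph"
  assumes H: "pair_graph H" "pverts H \<noteq> {}"
    and form: "\<And>x. (\<Sum>e\<in>parcs H. x (fst e) * x (snd e)) \<le> C * (\<Sum>v\<in>pverts H. (x v)\<^sup>2)"
  shows "graph_spectral_radius H \<le> C"
proof -
  interpret pair_graph H by fact
  have fin: "finite (pverts H)" by (rule pair_finite_verts)
  have "spectrum (adjacency_matrix H) \<noteq> {}"
    using adjacency_eigenvalue_exists[OF fin H(2) arcs_symmetric] spectrum_adjacency_iff[OF fin]
    by blast
  then have "graph_spectral_radius H \<in> spectrum (adjacency_matrix H)"
    unfolding graph_spectral_radius_def by (rule Max_in[OF finite_spectrum_adjacency])
  then obtain y where "adjacency_eigenvalue H (graph_spectral_radius H) y"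
    using spectrum_adjacency_iff[OF fin] by blast
  then obtain w where y: "w \<in> pverts H" "y w \<noteq> 0"
    "\<And>u. u \<in> pverts H \<Longrightarrow>
      (\<Sum>v\<in>pverts H. of_bool ((u, v) \<in> parcs H) * y v) = graph_spectral_radius H * y u"
    by (auto simp: adjacency_eigenvalue_def)
  have sub: "parcs H \<subseteq> pverts H \<times> pverts H" using wellformed' by auto
  have "graph_spectral_radius H * (\<Sum>v\<in>pverts H. (y v)\<^sup>2)
      = (\<Sum>u\<in>pverts H. y u * (\<Sum>v\<in>pverts H. of_bool ((u, v) \<in> parcs H) * y v))"
    using y(3) by (simp add: sum_distrib_left power2_eq_square mult_ac)
  also have "\<dots> = (\<Sum>(u, v)\<in>pverts H \<times> pverts H. of_bool ((u, v) \<in> parcs H) * (y u * y v))"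
    unfolding sum_distrib_left sum.cartesian_product by (intro sum.cong) auto
  also have "\<dots> = (\<Sum>e\<in>parcs H. y (fst e) * y (snd e))"
    using sub fin by (intro sum.mono_neutral_cong_right) auto
  also have "\<dots> \<le> C * (\<Sum>v\<in>pverts H. (y v)\<^sup>2)" by (rule form)
  finally have "graph_spectral_radius H * (\<Sum>v\<in>pverts H. (y v)\<^sup>2) \<le> C * (\<Sum>v\<in>pverts H. (y v)\<^sup>2)" .
  moreover have "(\<Sum>v\<in>pverts H. (y v)\<^sup>2) > 0"
    using y(1,2) fin by (intro sum_pos2[of _ w]) auto
  ultimately show ?thesis by simp
qed

section \<open>Spectral degeneracy\<close>

lemma max_degree_ge:
  assumes "finite (pverts G)" "v \<in> pverts G"
  shows "card {e\<in>parcs G. fst e = v} \<le> max_degree G"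
  using assms unfolding max_degree_def
  by (intro Max_ge) (auto simp: out_degree_def out_arcs_def)

lemma max_degree_less:
  assumes "pair_graph G" "pverts G \<noteq> {}"
  shows "max_degree G < card (pverts G)"
proof -
  interpret pair_graph G by fact
  have "out_degree (with_proj G) v < card (pverts G)" if v: "v \<in> pverts G" for v
  proof -
    have "{e\<in>parcs G. fst e = v} \<subseteq> Pair v ` (pverts G - {v})"
      using wellformed' no_loops' by force
    then have "card {e\<in>parcs G. fst e = v} \<le> card (Pair v ` (pverts G - {v}))"
      by (intro card_mono) (auto simp: pair_finite_verts)
    also have "\<dots> \<le> card (pverts G - {v})" by (rule card_image_le) (simp add: pair_finite_verts)
    also have "\<dots> < card (pverts G)" using v by (intro psubset_card_mono) (auto simp: pair_finite_verts)
    finally show ?thesis by (simp add: out_degree_def out_arcs_def)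
  qed
  then show ?thesis unfolding max_degree_def
    using assms(2) pair_finite_verts by (subst Max_less_iff) auto
qed

text \<open>The admissible values of \<open>d\<close> form a closed set that is bounded below, so
  the real \<open>LEAST\<close> is attained at its infimum. Positivity, without which the ratio
  would be a division by zero, comes from a single edge: the constant vector is an eigenvector for
  the eigenvalue 1, which rules out 0.\<close>

lemma spectral_degeneracy_bounds:
  fixes G :: "'a::linorder pair_pre_digraph"
  assumes G: "pair_graph G" "parcs G \<noteq> {}"
    and d: "0 \<le> d" "spectrally_degenerate d G"
  shows "0 < spectral_degeneracy G" "spectral_degeneracy G \<le> d"
proof -
  interpret pair_graph G by fact
  define S where "S = {d. 0 \<le> d \<and> spectrally_degenerate d G}"
  have "S = {0..} \<inter> (\<Inter>H\<in>{H. nonempty_subgraph H G}.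
      {d. graph_spectral_radius H \<le> sqrt (d * real (max_degree H))})"
    by (auto simp: S_def spectrally_degenerate_def)
  also have "closed \<dots>"
    by (intro closed_Int closed_atLeast closed_INT ballI closed_Collect_le continuous_intros)
  finally have "closed S" .
  have S: "d \<in> S" "bdd_below S" using d by (auto simp: S_def)
  have "Inf S \<in> S" using S \<open>closed S\<close> by (intro closed_contains_Inf) auto
  have eq: "spectral_degeneracy G = Inf S"
    unfolding spectral_degeneracy_def
  proof (rule Least_equality)
    show "0 \<le> Inf S \<and> spectrally_degenerate (Inf S) G" using \<open>Inf S \<in> S\<close> by (simp add: S_def)
    show "Inf S \<le> y" if "0 \<le> y \<and> spectrally_degenerate y G" for y
      using that S(2) by (intro cInf_lower) (auto simp: S_def)
  qed
  show "spectral_degeneracy G \<le> d" unfolding eq using S by (intro cInf_lower) auto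
  have "\<not> spectrally_degenerate 0 G"
  proof
    assume deg: "spectrally_degenerate 0 G"
    from G(2) obtain u v where uv: "(u, v) \<in> parcs G" by auto
    have "u \<noteq> v" using no_loops'[OF uv] .
    define K where "K = \<lparr>pverts = {u, v}, parcs = {(u, v), (v, u)}\<rparr>"
    have K: "pair_graph K"
      by unfold_locales (use \<open>u \<noteq> v\<close> in \<open>auto simp: K_def symmetric_def sym_def\<close>)
    then interpret K: pair_graph K .
    have "subgraph (with_proj K) (with_proj G)"
      using uv arcs_symmetric[OF uv] wellformed'[OF uv]
      by (intro subgraphI K.wf_digraph_axioms wf_digraph_axioms) (auto simp: K_def)
    then have "nonempty_subgraph K G"
      using K by (auto simp: nonempty_subgraph_def K_def)
    with deg have "graph_spectral_radius K \<le> 0"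
      by (auto simp: spectrally_degenerate_def)
    moreover have "adjacency_eigenvalue K 1 (\<lambda>_. 1)"
      using \<open>u \<noteq> v\<close> by (auto simp: adjacency_eigenvalue_def K_def)
    then have "1 \<le> graph_spectral_radius K"
      by (intro adjacency_eigenvalue_le[OF K.pair_finite_verts])
    ultimately show False by simp
  qed
  then have "Inf S \<noteq> 0" using \<open>Inf S \<in> S\<close> by (auto simp: S_def)
  then show "0 < spectral_degeneracy G" using \<open>Inf S \<in> S\<close> by (simp add: eq S_def)
qed

section \<open>Splitting sparse bipartite graphs\<close>

lemma card_eq_sum_fibres:
  assumes "finite P" "finite X" "g ` P \<subseteq> X"
  shows "card P = (\<Sum>u\<in>X. card {q\<in>P. g q = u})"
  using sum.group[OF assms, of "\<lambda>_. 1::nat"] by simp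

text \<open>Peeling: remove a vertex of degree at most \<open>k\<close> together with its remaining
  edges and assign these edges to the side of that vertex. No edge at this vertex is left
  afterwards, so each vertex is charged for at most one such batch.\<close>

lemma split_by_degeneracy:
  assumes "finite Q"
    and "\<And>R. R \<subseteq> Q \<Longrightarrow> R \<noteq> {} \<Longrightarrow>
      (\<exists>u\<in>g ` R. card {x\<in>R. g x = u} \<le> k) \<or> (\<exists>w\<in>h ` R. card {x\<in>R. h x = w} \<le> k)"
  shows "\<exists>Q1\<subseteq>Q. (\<forall>u. card {x\<in>Q1. g x = u} \<le> k) \<and> (\<forall>w. card {x\<in>Q - Q1. h x = w} \<le> k)"
  using assms
proof (induction rule: finite_psubset_induct)
  case (psubset Q)
  show ?case
  proof (cases "Q = {}")
    case True
    then show ?thesis by auto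
  next
    case False
    with psubset.prems[of Q] consider
      u where "u \<in> g ` Q" "card {x\<in>Q. g x = u} \<le> k" |
      w where "w \<in> h ` Q" "card {x\<in>Q. h x = w} \<le> k" by blast
    then show ?thesis
    proof cases
      case 1
      define X where "X = {x\<in>Q. g x = u}"
      have "Q - X \<subset> Q" using 1(1) by (auto simp: X_def)
      moreover have "(\<exists>u\<in>g ` R. card {x\<in>R. g x = u} \<le> k) \<or> (\<exists>w\<in>h ` R. card {x\<in>R. h x = w} \<le> k)"
        if "R \<subseteq> Q - X" "R \<noteq> {}" for R using that by (intro psubset.prems) auto
      ultimately obtain Q1 where Q1: "Q1 \<subseteq> Q - X" "\<And>u. card {x\<in>Q1. g x = u} \<le> k"
        "\<And>w. card {x\<in>Q - X - Q1. h x = w} \<le> k"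
        using psubset.IH[of "Q - X"] by blast
      have "card {x\<in>Q1 \<union> X. g x = u'} \<le> k" for u'
      proof (cases "u' = u")
        case True
        then have "{x\<in>Q1 \<union> X. g x = u'} = X" using Q1(1) by (auto simp: X_def)
        then show ?thesis using 1(2) by (simp add: X_def)
      next
        case False
        then have "{x\<in>Q1 \<union> X. g x = u'} = {x\<in>Q1. g x = u'}" by (auto simp: X_def)
        then show ?thesis using Q1(2) by simp
      qed
      moreover have "Q - (Q1 \<union> X) = Q - X - Q1" by auto
      moreover have "Q1 \<union> X \<subseteq> Q" using Q1(1) by (auto simp: X_def)
      ultimately show ?thesis using Q1(3) by (intro exI[of _ "Q1 \<union> X"]) auto
    next
      case 2
      define X where "X = {x\<in>Q. h x = w}"
      have "Q - X \<subset> Q" using 2(1) by (auto simp: X_def)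
      moreover have "(\<exists>u\<in>g ` R. card {x\<in>R. g x = u} \<le> k) \<or> (\<exists>w\<in>h ` R. card {x\<in>R. h x = w} \<le> k)"
        if "R \<subseteq> Q - X" "R \<noteq> {}" for R using that by (intro psubset.prems) auto
      ultimately obtain Q1 where Q1: "Q1 \<subseteq> Q - X" "\<And>u. card {x\<in>Q1. g x = u} \<le> k"
        "\<And>w. card {x\<in>Q - X - Q1. h x = w} \<le> k"
        using psubset.IH[of "Q - X"] by blast
      have "card {x\<in>Q - Q1. h x = w'} \<le> k" for w'
      proof (cases "w' = w")
        case True
        then have "{x\<in>Q - Q1. h x = w'} = X" using Q1(1) by (auto simp: X_def)
        then show ?thesis using 2(2) by (simp add: X_def)
      next
        case False
        then have "{x\<in>Q - Q1. h x = w'} = {x\<in>Q - X - Q1. h x = w'}" by (auto simp: X_def)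
        then show ?thesis using Q1(3) by simp
      qed
      then show ?thesis using Q1(1,2) by (intro exI[of _ Q1]) auto
    qed
  qed
qed

text \<open>Young's inequality with the weight \<open>s = sqrt (\<beta> / \<alpha>)\<close>, which
  makes the coefficients of both sides equal to \<open>sqrt (\<alpha> * \<beta>)\<close>. As the
  sides are disjoint, the two sums of squares merge into one without a factor 2.\<close>

lemma bipartite_form_le:
  fixes x :: "'v \<Rightarrow> real"
  assumes fin: "finite Q" "finite V" and V: "g ` Q \<subseteq> V" "h ` Q \<subseteq> V"
    and disj: "g ` Q \<inter> h ` Q = {}" and pos: "\<alpha> > 0" "\<beta> > 0"
    and \<alpha>: "\<And>u. u \<in> g ` Q \<Longrightarrow> real (card {q\<in>Q. g q = u}) \<le> \<alpha>"
    and \<beta>: "\<And>w. w \<in> h ` Q \<Longrightarrow> real (card {q\<in>Q. h q = w}) \<le> \<beta>"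
  shows "2 * (\<Sum>q\<in>Q. x (g q) * x (h q)) \<le> sqrt (\<alpha> * \<beta>) * (\<Sum>v\<in>V. (x v)\<^sup>2)"
proof -
  define s where "s = sqrt (\<beta> / \<alpha>)"
  have s: "s > 0" "\<alpha> * s = sqrt (\<alpha> * \<beta>)" "\<beta> * (1 / s) = sqrt (\<alpha> * \<beta>)"
    using pos by (simp_all add: s_def real_sqrt_divide real_sqrt_mult field_simps)
  have young: "2 * (y * z) \<le> s * y\<^sup>2 + 1 / s * z\<^sup>2" for y z :: real
  proof -
    have "0 \<le> (s * y - z)\<^sup>2 / s" using s(1) by simp
    also have "\<dots> = s * y\<^sup>2 + 1 / s * z\<^sup>2 - 2 * (y * z)"
      using s(1) by (simp add: power2_eq_square field_simps)
    finally show ?thesis by simp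
  qed
  have fibres: "(\<Sum>q\<in>Q. t * (x (k q))\<^sup>2) \<le> \<gamma> * t * (\<Sum>v\<in>k ` Q. (x v)\<^sup>2)"
    if \<gamma>: "\<And>u. u \<in> k ` Q \<Longrightarrow> real (card {q\<in>Q. k q = u}) \<le> \<gamma>" and t: "t \<ge> 0"
    for k :: "_ \<Rightarrow> 'v" and \<gamma> t
  proof -
    have "(\<Sum>q\<in>Q. t * (x (k q))\<^sup>2) = (\<Sum>u\<in>k ` Q. \<Sum>q\<in>{q\<in>Q. k q = u}. t * (x (k q))\<^sup>2)"
      using fin(1) by (rule sum.image_gen)
    also have "\<dots> = (\<Sum>u\<in>k ` Q. real (card {q\<in>Q. k q = u}) * (t * (x u)\<^sup>2))"
      by (intro sum.cong) auto
    also have "\<dots> \<le> (\<Sum>u\<in>k ` Q. \<gamma> * (t * (x u)\<^sup>2))"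
      using \<gamma> t by (intro sum_mono mult_right_mono) auto
    finally show ?thesis by (simp add: sum_distrib_left mult_ac)
  qed
  have "2 * (\<Sum>q\<in>Q. x (g q) * x (h q)) \<le> (\<Sum>q\<in>Q. s * (x (g q))\<^sup>2 + 1 / s * (x (h q))\<^sup>2)"
    unfolding sum_distrib_left by (intro sum_mono young)
  also have "\<dots> \<le> \<alpha> * s * (\<Sum>v\<in>g ` Q. (x v)\<^sup>2) + \<beta> * (1 / s) * (\<Sum>v\<in>h ` Q. (x v)\<^sup>2)"
    unfolding sum.distrib using \<alpha> \<beta> s(1) by (intro add_mono fibres) auto
  also have "\<dots> = sqrt (\<alpha> * \<beta>) * (\<Sum>v\<in>g ` Q \<union> h ` Q. (x v)\<^sup>2)"
    unfolding s using fin(1) disj by (subst sum.union_disjoint) (auto simp: distrib_left)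
  also have "\<dots> \<le> sqrt (\<alpha> * \<beta>) * (\<Sum>v\<in>V. (x v)\<^sup>2)"
    using pos V fin by (intro mult_left_mono sum_mono2) auto
  finally show ?thesis .
qed

section \<open>Layered bipartite graphs\<close>

text \<open>The edges are the pairs \<open>(a, i)\<close> with \<open>a < N\<close> and \<open>i < M\<close>; such an edge joins \<open>a\<close> to
  \<open>f (a, i)\<close> in the layer \<open>B i\<close>, whose vertices have average degree \<open>d i\<close>.\<close>

locale layered =
  fixes N M :: nat and d :: "nat \<Rightarrow> nat" and B :: "nat \<Rightarrow> nat set" and f :: "nat \<times> nat \<Rightarrow> nat"
  assumes M: "2 \<le> M" and N: "0 < N"
    and d_pos: "\<And>i. 0 < d i" and d_growth: "\<And>i. 4 * d i \<le> d (Suc i)"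
    and finite_B: "\<And>i. i < M \<Longrightarrow> finite (B i)"
    and disjoint_B: "\<And>i j. i < M \<Longrightarrow> j < M \<Longrightarrow> i \<noteq> j \<Longrightarrow> B i \<inter> B j = {}"
    and B_ge: "\<And>i v. i < M \<Longrightarrow> v \<in> B i \<Longrightarrow> N \<le> v"
    and B_less: "\<And>i v. i < M \<Longrightarrow> v \<in> B i \<Longrightarrow> v < 2 * N"
    and card_B: "\<And>i. i < M \<Longrightarrow> card (B i) * d i = N"
    and f_mem: "\<And>a i. a < N \<Longrightarrow> i < M \<Longrightarrow> f (a, i) \<in> B i"
    and f_degree: "\<And>i v. i < M \<Longrightarrow> card {a. a < N \<and> f (a, i) = v} \<le> 6 * d i"
    and sparse: "\<And>m W P. 0 < m \<Longrightarrow> m < M \<Longrightarrow> W \<noteq> {} \<Longrightarrow>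
      W \<subseteq> {..<2 * N} \<Longrightarrow> card W * d m \<le> 2 * M\<^sup>2 * d (m - 1) * N \<Longrightarrow>
      P \<subseteq> (W \<inter> {..<N}) \<times> {..<m} \<Longrightarrow> f ` P \<subseteq> W \<Longrightarrow> card P < 2 * card W"
begin

lemma d_mono: "i \<le> j \<Longrightarrow> d i \<le> d j"
proof (rule lift_Suc_mono_le[of d])
  show "d n \<le> d (Suc n)" for n using d_growth[of n] by linarith
qed

lemma f_level:
  assumes "f q = f q'" "q \<in> {..<N} \<times> {..<M}" "q' \<in> {..<N} \<times> {..<M}"
  shows "snd q = snd q'"
proof (rule ccontr)
  assume "snd q \<noteq> snd q'"
  then have "B (snd q) \<inter> B (snd q') = {}" using assms by (intro disjoint_B) auto
  moreover have "f q \<in> B (snd q)" "f q' \<in> B (snd q')"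
    using assms f_mem[of "fst q" "snd q"] f_mem[of "fst q'" "snd q'"] by auto
  ultimately show False using assms(1) by auto
qed

text \<open>In a subgraph of minimum degree 9 above level \<open>j\<close>, let \<open>m\<close> be the highest level such that
  many vertices of the left side have their topmost edge at level \<open>m\<close>. As the degrees are at most
  \<open>D\<close>, the left side is small compared with \<open>N / d (m - 1)\<close>, and so its edges below
  level \<open>m\<close> contradict sparsity.\<close>

lemma upper_levels_degenerate:
  assumes Q: "Q \<subseteq> {..<N} \<times> {j<..<M}" "Q \<noteq> {}" and D: "D < d j"
    and deg: "\<And>v. card {q\<in>Q. f q = v} \<le> D"
  shows "(\<exists>u\<in>fst ` Q. card {q\<in>Q. fst q = u} \<le> 8) \<or> (\<exists>w\<in>f ` Q. card {q\<in>Q. f q = w} \<le> 8)"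
proof (rule ccontr)
  assume "\<not> ?thesis"
  then have degA: "\<And>u. u \<in> fst ` Q \<Longrightarrow> 9 \<le> card {q\<in>Q. fst q = u}"
    and degB: "\<And>w. w \<in> f ` Q \<Longrightarrow> 9 \<le> card {q\<in>Q. f q = w}"
    by (auto simp: not_le)
  have fin: "finite Q" using Q(1) by (rule finite_subset) auto
  define A where "A = fst ` Q"
  define a where "a = card A"
  have finA: "finite A" using fin by (simp add: A_def)
  have a: "a > 0" using Q(2) finA by (auto simp: a_def A_def card_gt_0_iff)
  define top where "top u = Max {i. (u, i) \<in> Q}" for u
  have fin_levels: "finite {i. (u, i) \<in> Q}" for u
    by (rule finite_subset[of _ "snd ` Q"]) (use fin in force)+
  have top_mem: "(u, top u) \<in> Q" if "u \<in> A" for u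
  proof -
    have "{i. (u, i) \<in> Q} \<noteq> {}" using that by (auto simp: A_def)
    from Max_in[OF fin_levels this] show ?thesis by (simp add: top_def)
  qed
  have top_ge: "i \<le> top u" if "(u, i) \<in> Q" for u i
    unfolding top_def using that fin_levels by (intro Max_ge) auto
  have top_less: "top u < M" if "u \<in> A" for u using top_mem[OF that] Q(1) by auto
  define T where "T m = {u\<in>A. top u = m}" for m
  have finT: "finite (T m)" for m using finA by (simp add: T_def)
  have a_sum: "a = (\<Sum>m<M. card (T m))"
    unfolding a_def T_def using finA top_less by (intro card_eq_sum_fibres) auto
  \<comment> \<open>By pigeonhole some level is the top of at least \<open>a / (2 * M)\<close> left
    vertices. The factor 2 makes all levels above the last such level account for at most half of
    \<open>A\<close>.\<close>
  define I where "I = {m. m < M \<and> a \<le> 2 * M * card (T m)}"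
  have "I \<noteq> {}"
  proof
    assume "I = {}"
    then have "2 * M * card (T m) \<le> a" if "m < M" for m using that by (force simp: I_def)
    then have "(\<Sum>m<M. 2 * M * card (T m)) \<le> (\<Sum>m<M. a)" by (intro sum_mono) auto
    then show False using a M unfolding sum_distrib_left[symmetric] a_sum[symmetric] by simp
  qed
  moreover have finI: "finite I" by (simp add: I_def)
  ultimately have "Max I \<in> I" by (intro Max_in)
  define m where "m = Max I"
  have m: "m < M" "a \<le> 2 * M * card (T m)" using \<open>Max I \<in> I\<close> by (auto simp: I_def m_def)
  have above: "2 * M * card (T i) \<le> a" if "m < i" "i < M" for i
  proof (rule ccontr)
    assume "\<not> ?thesis"
    then have "i \<in> I" using that by (auto simp: I_def)
    then have "i \<le> m" unfolding m_def using finI by (intro Max_ge)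
    with that show False by simp
  qed
  define U where "U = {u\<in>A. top u \<le> m}"
  have finU: "finite U" using finA by (simp add: U_def)
  have "card (A - U) = (\<Sum>i\<in>{m<..<M}. card {u\<in>A - U. top u = i})"
    using finA top_less by (intro card_eq_sum_fibres) (auto simp: U_def)
  also have "\<dots> \<le> (\<Sum>i\<in>{m<..<M}. card (T i))"
    using finT by (intro sum_mono card_mono) (auto simp: T_def)
  finally have "2 * M * card (A - U) \<le> (\<Sum>i\<in>{m<..<M}. 2 * M * card (T i))"
    unfolding sum_distrib_left[symmetric] by (intro mult_left_mono) auto
  also have "\<dots> \<le> (\<Sum>i\<in>{m<..<M}. a)" using above by (intro sum_mono) auto
  also have "\<dots> \<le> M * a" by simp
  finally have "M * (2 * card (A - U)) \<le> M * a" by simp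
  then have "2 * card (A - U) \<le> a" using M by simp
  moreover have "card (A - U) = a - card U" "card U \<le> a"
    unfolding a_def using finA finU by (auto simp: U_def intro!: card_Diff_subset card_mono)
  ultimately have U: "a \<le> 2 * card U" by simp
  define P where "P = {q\<in>Q. snd q < m}"
  have finP: "finite P" using fin by (simp add: P_def)
  \<comment> \<open>A vertex of \<open>U\<close> has at most one edge at level \<open>m\<close> and
    none above, so at least 8 of its 9 edges survive in \<open>P\<close>.\<close>
  have "8 * card U = (\<Sum>u\<in>U. 8)" by simp
  also have "\<dots> \<le> (\<Sum>u\<in>U. card {q\<in>P. fst q = u})"
  proof (intro sum_mono)
    fix u assume u: "u \<in> U"
    have "{q\<in>Q. fst q = u} \<subseteq> insert (u, m) {q\<in>P. fst q = u}"
      using u top_ge by (fastforce simp: U_def P_def)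
    then have "card {q\<in>Q. fst q = u} \<le> card (insert (u, m) {q\<in>P. fst q = u})"
      using finP by (intro card_mono) auto
    also have "\<dots> \<le> Suc (card {q\<in>P. fst q = u})" by (rule card_insert_le_m1) auto
    finally show "8 \<le> card {q\<in>P. fst q = u}" using degA[of u] u by (simp add: U_def A_def)
  qed
  also have "\<dots> \<le> (\<Sum>u\<in>A. card {q\<in>P. fst q = u})"
    using finA by (intro sum_mono2) (auto simp: U_def)
  also have "\<dots> = card P"
    using finP finA by (intro card_eq_sum_fibres[symmetric]) (auto simp: P_def A_def)
  finally have P_A: "4 * a \<le> card P" using U by simp
  \<comment> \<open>The edges at a right vertex all lie in one level, so passing from
    \<open>Q\<close> to \<open>P\<close> loses none of them.\<close>
  have P_B: "9 * card (f ` P) \<le> card P"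
  proof -
    have "9 * card (f ` P) = (\<Sum>v\<in>f ` P. 9)" by simp
    also have "\<dots> \<le> (\<Sum>v\<in>f ` P. card {q\<in>P. f q = v})"
    proof (intro sum_mono)
      fix v assume v: "v \<in> f ` P"
      then obtain p where p: "p \<in> P" "v = f p" by auto
      have "{q\<in>Q. f q = v} \<subseteq> {q\<in>P. f q = v}"
      proof safe
        fix a i assume q: "(a, i) \<in> Q" "v = f (a, i)"
        have "snd (a, i) = snd p"
          using q p Q(1) by (intro f_level) (auto simp: P_def)
        then show "(a, i) \<in> P" using q(1) p(1) by (auto simp: P_def)
      qed
      then have "card {q\<in>Q. f q = v} \<le> card {q\<in>P. f q = v}"
        using finP by (intro card_mono) auto
      then show "9 \<le> card {q\<in>P. f q = v}" using degB[of v] v by (force simp: P_def)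
    qed
    also have "\<dots> = card P" using finP by (intro card_eq_sum_fibres[symmetric]) auto
    finally show ?thesis .
  qed
  \<comment> \<open>An edge of \<open>P\<close> lies at a level strictly between \<open>j\<close>
    and \<open>m\<close>. This is what allows \<open>D < d j\<close> to be compared with
    \<open>d (m - 1)\<close>.\<close>
  have "card P > 0" using P_A a by simp
  then obtain p where "p \<in> P" by (auto simp: card_gt_0_iff)
  then have "j < snd p" "snd p < m" using Q(1) by (auto simp: P_def)
  then have jm: "j \<le> m - 1" "0 < m" by auto
  have Dm: "D \<le> d (m - 1)" using d_mono[OF jm(1)] D by simp
  \<comment> \<open>The topmost edges of the vertices in \<open>T m\<close> are distinct and end in
    \<open>B m\<close>, where degrees are at most \<open>D\<close>.\<close>
  have t: "card (T m) \<le> D * card (B m)"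
  proof -
    have "card (T m) = card ((\<lambda>u. (u, m)) ` T m)" by (intro card_image[symmetric]) (auto simp: inj_on_def)
    also have "\<dots> \<le> card {q\<in>Q. snd q = m}"
      using fin top_mem by (intro card_mono) (auto simp: T_def)
    also have "\<dots> = (\<Sum>v\<in>B m. card {q\<in>{q\<in>Q. snd q = m}. f q = v})"
      using fin finite_B[OF m(1)] Q(1) f_mem m(1) by (intro card_eq_sum_fibres) auto
    also have "\<dots> \<le> (\<Sum>v\<in>B m. D)"
      using fin by (intro sum_mono order_trans[OF card_mono deg]) auto
    finally show ?thesis by (simp add: mult.commute)
  qed
  \<comment> \<open>The size condition in \<open>sparse\<close> is made for this set:
    \<open>card W\<close> is at most \<open>M * a\<close>, hence at most
    \<open>2 * M ^ 2 * D * card (B m)\<close>, and \<open>card (B m) * d m = N\<close>.\<close>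
  define W where "W = A \<union> f ` P"
  have finW: "finite W" using finA finP by (simp add: W_def)
  have cW: "card W \<le> a + card (f ` P)" unfolding W_def a_def by (rule card_Un_le)
  have "card P \<le> card (A \<times> {..<M})"
    using finA Q(1) by (intro card_mono) (auto simp: P_def A_def image_iff Bex_def)
  then have "card P \<le> a * M" by (simp add: a_def card_cartesian_product)
  then have "9 * card W \<le> 9 * a + a * M" using cW P_B by simp
  also have "\<dots> \<le> 9 * (M * a)"
  proof -
    have "9 * a * 1 + a * M \<le> 8 * a * M + a * M" using M by (intro add_mono) auto
    then show ?thesis by (simp add: mult_ac)
  qed
  finally have "card W \<le> M * a" by simp
  also have "\<dots> \<le> M * (2 * M * (D * card (B m)))"
    using m(2) t by (intro mult_left_mono order_trans[OF m(2)]) auto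
  finally have "card W * d m \<le> M * (2 * M * (D * card (B m))) * d m" by simp
  also have "\<dots> = 2 * M\<^sup>2 * D * (card (B m) * d m)" by (simp add: power2_eq_square mult_ac)
  also have "\<dots> \<le> 2 * M\<^sup>2 * d (m - 1) * N" unfolding card_B[OF m(1)] using Dm by simp
  finally have small: "card W * d m \<le> 2 * M\<^sup>2 * d (m - 1) * N" .
  have "card P < 2 * card W"
  proof (rule sparse[OF jm(2) m(1) _ _ small])
    show "W \<noteq> {}" using a by (auto simp: W_def a_def)
    have "f q < 2 * N" if "q \<in> Q" for q
      using that Q(1) f_mem[of "fst q" "snd q"] B_less[of "snd q" "f q"] by auto
    then show "W \<subseteq> {..<2 * N}" using Q(1) by (fastforce simp: W_def A_def P_def)
    show "P \<subseteq> (W \<inter> {..<N}) \<times> {..<m}" using Q(1) by (force simp: P_def W_def A_def)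
  qed (simp add: W_def)
  \<comment> \<open>\<open>card W\<close> is at most \<open>card P / 4 + card P / 9\<close>, which
    is less than \<open>card P / 2\<close>.\<close>
  with cW P_A P_B \<open>card P > 0\<close> show False by simp
qed

lemma sum_sqrt_d_le: "(\<Sum>i<Suc j. sqrt (d i)) \<le> 2 * sqrt (d j)"
proof (induction j)
  case (Suc j)
  have "2 * sqrt (d j) = sqrt (4 * d j)" by (simp add: real_sqrt_mult)
  also have "\<dots> \<le> sqrt (d (Suc j))" using d_growth[of j] by (simp flip: of_nat_mult)
  finally show ?case using Suc by simp
qed simp

text \<open>The constant is 5 + 1 + 6: below the threshold the stars have up to
  \<open>6 * d i\<close> edges and \<open>2 * sqrt 6\<close> is at most 5; the threshold layer is a
  star forest of degree at most \<open>D\<close>; above it, two pieces have degree at most 8 on one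
  side and \<open>D\<close> on the other, and \<open>sqrt 8\<close> is at most 3.\<close>

lemma layered_form_le:
  fixes x :: "nat \<Rightarrow> real"
  assumes Q: "Q \<subseteq> {..<N} \<times> {..<M}" and D: "0 < D"
    and degA: "\<And>u. card {q\<in>Q. fst q = u} \<le> D" and degB: "\<And>v. card {q\<in>Q. f q = v} \<le> D"
    and V: "finite V" "fst ` Q \<subseteq> V" "f ` Q \<subseteq> V"
  shows "2 * (\<Sum>q\<in>Q. x (fst q) * x (f q)) \<le> 12 * sqrt D * (\<Sum>v\<in>V. (x v)\<^sup>2)"
proof -
  have fin: "finite Q" using Q by (rule finite_subset) auto
  define S where "S = (\<Sum>v\<in>V. (x v)\<^sup>2)"
  have S: "0 \<le> S" by (simp add: S_def sum_nonneg)
  have form: "2 * (\<Sum>q\<in>R. x (fst q) * x (f q)) \<le> sqrt (\<alpha> * \<beta>) * S"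
    if R: "R \<subseteq> Q" and pos: "\<alpha> > 0" "\<beta> > 0"
      and \<alpha>: "\<And>u. real (card {q\<in>R. fst q = u}) \<le> \<alpha>"
      and \<beta>: "\<And>w. real (card {q\<in>R. f q = w}) \<le> \<beta>" for R \<alpha> \<beta>
    unfolding S_def
  proof (rule bipartite_form_le)
    have "fst q < N" if "q \<in> R" for q using that R Q by auto
    moreover have "N \<le> f q" if "q \<in> R" for q
      using that R Q f_mem[of "fst q" "snd q"] B_ge[of "snd q" "f q"] by auto
    ultimately show "fst ` R \<inter> f ` R = {}" by (fastforce simp: disjoint_iff image_iff)
  qed (use R fin V pos \<alpha> \<beta> in \<open>auto intro: finite_subset\<close>)
  have card_R: "real (card {q\<in>R. g q = u}) \<le> D" if "R \<subseteq> Q" "card {q\<in>Q. g q = u} \<le> D"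
    for R and g :: "nat \<times> nat \<Rightarrow> nat" and u
  proof -
    have "card {q\<in>R. g q = u} \<le> card {q\<in>Q. g q = u}"
      using fin that(1) by (intro card_mono) auto
    with that(2) show ?thesis by simp
  qed
  define L where "L i = {q\<in>Q. snd q = i}" for i
  have L_sub: "L i \<subseteq> Q" for i by (auto simp: L_def)
  have L_fst: "real (card {q\<in>L i. fst q = u}) \<le> 1" for i u
  proof -
    have "card {q\<in>L i. fst q = u} \<le> card {(u, i)}" by (intro card_mono) (auto simp: L_def)
    then show ?thesis by simp
  qed
  have L_f: "real (card {q\<in>L i. f q = v}) \<le> 6 * d i" if "i < M" for i v
  proof -
    have "card {q\<in>L i. f q = v} = card (fst ` {q\<in>L i. f q = v})"
      by (intro card_image[symmetric]) (auto simp: inj_on_def L_def)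
    also have "\<dots> \<le> card {a. a < N \<and> f (a, i) = v}"
      using Q by (intro card_mono) (auto simp: L_def)
    also have "\<dots> \<le> 6 * d i" by (rule f_degree[OF that])
    finally show ?thesis by (simp flip: of_nat_mult)
  qed
  have L_all: "2 * (\<Sum>q\<in>L i. x (fst q) * x (f q)) \<le> sqrt (6 * d i) * S" if "i < M" for i
    using form[OF L_sub, of 1 "6 * d i" i] L_fst L_f[OF that] d_pos[of i] by simp
  \<comment> \<open>The alternative \<open>i = M\<close> caps the threshold when no layer exceeds
    \<open>D\<close>; in that case \<open>L j\<close> and \<open>U\<close> are empty.\<close>
  define j where "j = (LEAST i. i = M \<or> D < d i)"
  have j: "j = M \<or> D < d j" unfolding j_def by (rule LeastI[of _ M]) simp
  have below: "d i \<le> D" if "i < j" for i using not_less_Least[of i "\<lambda>i. i = M \<or> D < d i"] that by (auto simp: j_def)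
  have jM: "j \<le> M" unfolding j_def by (rule Least_le) simp
  have sqrt_below: "(\<Sum>i<j. sqrt (d i)) \<le> 2 * sqrt D"
  proof (cases j)
    case (Suc j')
    have "sqrt (d j') \<le> sqrt D" using below[of j'] Suc by simp
    with sum_sqrt_d_le[of j'] show ?thesis unfolding Suc by linarith
  qed simp
  define U where "U = {q\<in>Q. j < snd q}"
  have U_sub: "U \<subseteq> Q" by (auto simp: U_def)
  have low: "2 * (\<Sum>i<j. \<Sum>q\<in>L i. x (fst q) * x (f q)) \<le> 5 * sqrt D * S"
  proof -
    have "2 * (\<Sum>i<j. \<Sum>q\<in>L i. x (fst q) * x (f q)) \<le> (\<Sum>i<j. sqrt (6 * d i) * S)"
      using jM by (subst sum_distrib_left, intro sum_mono L_all) auto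
    also have "\<dots> = sqrt 6 * (\<Sum>i<j. sqrt (d i)) * S"
      by (simp add: real_sqrt_mult sum_distrib_left sum_distrib_right)
    also have "\<dots> \<le> (5 / 2) * (2 * sqrt D) * S"
    proof -
      have "sqrt 6 \<le> 5 / 2" by (rule real_le_lsqrt) (auto simp: power2_eq_square)
      then show ?thesis using sqrt_below S by (intro mult_right_mono mult_mono) (auto intro: sum_nonneg)
    qed
    finally show ?thesis by simp
  qed
  have mid: "2 * (\<Sum>q\<in>L j. x (fst q) * x (f q)) \<le> sqrt D * S"
    using form[OF L_sub, of 1 D j] L_fst card_R[OF L_sub degB] D by simp
  have high: "2 * (\<Sum>q\<in>U. x (fst q) * x (f q)) \<le> 6 * sqrt D * S"
  proof -
    have deg_U: "(\<exists>u\<in>fst ` R. card {q\<in>R. fst q = u} \<le> 8) \<or> (\<exists>w\<in>f ` R. card {q\<in>R. f q = w} \<le> 8)"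
      if R: "R \<subseteq> U" "R \<noteq> {}" for R
    proof (rule upper_levels_degenerate[of R j D])
      show R': "R \<subseteq> {..<N} \<times> {j<..<M}" using R Q by (force simp: U_def)
      then have "j \<noteq> M" using R(2) by auto
      then show "D < d j" using j by simp
      show "card {q\<in>R. f q = v} \<le> D" for v
        using card_R[of R f v] degB R(1) U_sub by auto
    qed fact
    have finU: "finite U" using U_sub fin by (rule finite_subset)
    obtain Q1 where Q1: "Q1 \<subseteq> U" "\<And>u. card {q\<in>Q1. fst q = u} \<le> 8"
      "\<And>w. card {q\<in>U - Q1. f q = w} \<le> 8"
      using split_by_degeneracy[OF finU deg_U] by blast
    have "sqrt (8 * real D) \<le> 3 * sqrt D"
      by (rule real_le_lsqrt) (auto simp: power_mult_distrib)
    then have le: "sqrt (8 * real D) * S \<le> 3 * sqrt D * S" using S by (intro mult_right_mono)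
    have "2 * (\<Sum>q\<in>Q1. x (fst q) * x (f q)) \<le> sqrt (8 * real D) * S"
      using Q1(1,2) U_sub D by (intro form card_R degB) auto
    moreover have "2 * (\<Sum>q\<in>U - Q1. x (fst q) * x (f q)) \<le> sqrt (real D * 8) * S"
      using Q1(3) U_sub D by (intro form card_R degA) auto
    moreover have "(\<Sum>q\<in>U. x (fst q) * x (f q)) =
        (\<Sum>q\<in>U - Q1. x (fst q) * x (f q)) + (\<Sum>q\<in>Q1. x (fst q) * x (f q))"
      using Q1(1) finU by (rule sum.subset_diff)
    ultimately show ?thesis using le by (simp add: mult.commute)
  qed
  have "Q = (\<Union>i<j. L i) \<union> L j \<union> U" by (auto simp: L_def U_def)
  also have "(\<Sum>q\<in>\<dots>. x (fst q) * x (f q)) = (\<Sum>i<j. \<Sum>q\<in>L i. x (fst q) * x (f q))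
      + (\<Sum>q\<in>L j. x (fst q) * x (f q)) + (\<Sum>q\<in>U. x (fst q) * x (f q))"
  proof -
    have finL: "finite (L i)" for i using L_sub fin by (rule finite_subset)
    have "finite U" using U_sub fin by (rule finite_subset)
    moreover have "((\<Union>i<j. L i) \<union> L j) \<inter> U = {}" "(\<Union>i<j. L i) \<inter> L j = {}"
      by (auto simp: L_def U_def)
    moreover have "(\<Sum>q\<in>(\<Union>i<j. L i). x (fst q) * x (f q)) = (\<Sum>i<j. \<Sum>q\<in>L i. x (fst q) * x (f q))"
      using finL by (intro sum.UNION_disjoint) (auto simp: L_def)
    ultimately show ?thesis using finL by (simp add: sum.union_disjoint)
  qed
  finally show ?thesis using low mid high by (simp add: S_def algebra_simps)
qed

end

section \<open>Random layers\<close>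

text \<open>Probabilities are expressed by counting functions. Independence of the values becomes
  the product formula for \<open>PiE\<close>, where each constrained coordinate contributes a factor
  \<open>r\<close>.\<close>

lemma card_PiE_constrained_le:
  fixes r :: real
  assumes fin: "finite I" "\<And>x. x \<in> I \<Longrightarrow> finite (B x)" and P: "P \<subseteq> I"
    and r: "\<And>x. x \<in> P \<Longrightarrow> real (card (S \<inter> B x)) \<le> r * real (card (B x))" "0 \<le> r"
  shows "real (card {g\<in>PiE I B. \<forall>x\<in>P. g x \<in> S}) \<le> r ^ card P * real (card (PiE I B))"
proof -
  have "{g\<in>PiE I B. \<forall>x\<in>P. g x \<in> S} = PiE I (\<lambda>x. if x \<in> P then S \<inter> B x else B x)"
  proof (intro Set.set_eqI iffI)
    fix g assume "g \<in> PiE I (\<lambda>x. if x \<in> P then S \<inter> B x else B x)"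
    have g: "g x \<in> (if x \<in> P then S \<inter> B x else B x)" if "x \<in> I" for x
      by (rule PiE_mem[OF \<open>g \<in> _\<close> that])
    have "g x \<in> B x" if "x \<in> I" for x using g[OF that] by (auto split: if_splits)
    moreover have "g x \<in> S" if "x \<in> P" for x using g[of x] that P by auto
    ultimately show "g \<in> {g\<in>PiE I B. \<forall>x\<in>P. g x \<in> S}"
      using \<open>g \<in> PiE I _\<close> by (auto simp: PiE_iff)
  next
    fix g assume "g \<in> {g\<in>PiE I B. \<forall>x\<in>P. g x \<in> S}"
    then show "g \<in> PiE I (\<lambda>x. if x \<in> P then S \<inter> B x else B x)"
      by (auto simp: PiE_iff)
  qed
  then have "real (card {g\<in>PiE I B. \<forall>x\<in>P. g x \<in> S})
      = (\<Prod>x\<in>I. real (card (if x \<in> P then S \<inter> B x else B x)))"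
    using fin(1) by (simp add: card_PiE)
  also have "\<dots> \<le> (\<Prod>x\<in>I. (if x \<in> P then r else 1) * real (card (B x)))"
    using r by (intro prod_mono) auto
  also have "\<dots> = (\<Prod>x\<in>I. if x \<in> P then r else 1) * (\<Prod>x\<in>I. real (card (B x)))"
    by (rule prod.distrib)
  also have "(\<Prod>x\<in>I. if x \<in> P then r else 1) = r ^ card P"
    using fin(1) P by (simp add: prod.If_cases Int_absorb1)
  also have "(\<Prod>x\<in>I. real (card (B x))) = real (card (PiE I B))"
    using fin(1) by (simp add: card_PiE)
  finally show ?thesis .
qed

lemma card_UN_le_sum:
  fixes c :: "'i \<Rightarrow> real"
  assumes "finite I" "\<And>i. i \<in> I \<Longrightarrow> real (card (A i)) \<le> c i"
  shows "real (card (\<Union>i\<in>I. A i)) \<le> sum c I"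
proof -
  have "real (card (\<Union>i\<in>I. A i)) \<le> (\<Sum>i\<in>I. real (card (A i)))"
    using card_UN_le[OF assms(1), of A] by (simp flip: of_nat_sum)
  also have "\<dots> \<le> sum c I" using assms(2) by (rule sum_mono)
  finally show ?thesis .
qed

section \<open>Estimates for binomial coefficients and geometric sums\<close>

lemma binomial_times_fact_le: "(n choose k) * fact k \<le> n ^ k"
proof (induction k arbitrary: n)
  case (Suc k)
  have "(n choose Suc k) * fact (Suc k) = (Suc k * (n choose Suc k)) * fact k"
    by (simp only: fact_Suc of_nat_id mult_ac)
  also have "\<dots> = n * (((n - 1) choose k) * fact k)"
    unfolding binomial_absorption by (simp add: mult_ac)
  also have "\<dots> \<le> n * (n - 1) ^ k" using Suc by (intro mult_left_mono) auto
  also have "\<dots> \<le> n * n ^ k" by (intro mult_left_mono power_mono) auto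
  finally show ?case by simp
qed simp

text \<open>\<open>k ^ k / fact k\<close> is a single term of the series of \<open>exp k\<close>,
  and \<open>exp 1\<close> is at most 3.\<close>

lemma power_self_le_fact: "real k ^ k \<le> 3 ^ k * fact k"
proof -
  have "(\<Sum>n\<in>{k}. real k ^ n /\<^sub>R fact n) \<le> (\<Sum>n. real k ^ n /\<^sub>R fact n)"
    by (intro sum_le_suminf summable_exp_generic) auto
  then have "real k ^ k / fact k \<le> exp (real k)" by (simp add: exp_def divide_inverse mult.commute)
  also have "\<dots> = exp 1 ^ k" by (simp flip: exp_of_nat_mult)
  also have "\<dots> \<le> 3 ^ k" by (intro power_mono exp_le) auto
  finally show ?thesis by (simp add: field_simps)
qed

lemma binomial_le_power:
  assumes "0 < k"
  shows "real (n choose k) \<le> (3 * real n / real k) ^ k"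
proof -
  have "real (n choose k) * fact k \<le> real n ^ k"
    using binomial_times_fact_le[of n k] by (metis of_nat_fact of_nat_le_iff of_nat_mult of_nat_power)
  then have "real (n choose k) * (real k ^ k) \<le> 3 ^ k * real n ^ k"
  proof -
    have "real (n choose k) * (real k ^ k) \<le> real (n choose k) * (3 ^ k * fact k)"
      by (intro mult_left_mono power_self_le_fact) auto
    also have "\<dots> = 3 ^ k * (real (n choose k) * fact k)" by simp
    also have "\<dots> \<le> 3 ^ k * real n ^ k"
      using \<open>real (n choose k) * fact k \<le> real n ^ k\<close> by (intro mult_left_mono) auto
    finally show ?thesis .
  qed
  then show ?thesis using assms by (simp add: field_simps)
qed

lemma sum_powers_le:
  fixes q :: real
  assumes "0 \<le> q" "q \<le> 1 / 4"
  shows "(\<Sum>w=1..n. q ^ w) \<le> 4 / 3 * q"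
proof -
  have "(1 - q) * (\<Sum>w=1..n. q ^ w) = q - q ^ Suc n"
  proof (induction n)
    case (Suc n)
    have "(1 - q) * (\<Sum>w=1..Suc n. q ^ w) = (1 - q) * (\<Sum>w=1..n. q ^ w) + (1 - q) * q ^ Suc n"
      by (simp add: distrib_left)
    also have "\<dots> = q - q ^ Suc (Suc n)" unfolding Suc by (simp add: algebra_simps)
    finally show ?case .
  qed simp
  also have "\<dots> \<le> q" using assms by simp
  finally have "(1 - q) * (\<Sum>w=1..n. q ^ w) \<le> q" .
  moreover have "3 / 4 * (\<Sum>w=1..n. q ^ w) \<le> (1 - q) * (\<Sum>w=1..n. q ^ w)"
    using assms by (intro mult_right_mono sum_nonneg) auto
  ultimately show ?thesis by simp
qed

text \<open>The union bound for a uniformly random \<open>f\<close>: the first kind of failure is a vertex of layer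
  \<open>i\<close> with many preimages, the second a vertex set \<open>W\<close> containing \<open>2 |W|\<close> edges.\<close>

lemma random_layers:
  fixes N M :: nat and d :: "nat \<Rightarrow> nat" and B :: "nat \<Rightarrow> nat set"
  assumes N: "0 < N" and d_pos: "\<And>i. 0 < d i" and d_mono: "\<And>i j. i \<le> j \<Longrightarrow> d i \<le> d j"
    and finite_B: "\<And>i. i < M \<Longrightarrow> finite (B i)"
    and card_B: "\<And>i. i < M \<Longrightarrow> card (B i) * d i = N"
    and d_growth: "\<And>m. 0 < m \<Longrightarrow> m < M \<Longrightarrow> 48 * M ^ 3 * 2 ^ M * d (m - 1) ^ 3 \<le> d m"
    and d_large: "\<And>i. i < M \<Longrightarrow> 4 * M * N \<le> 2 ^ (6 * d i)"
  obtains f where "\<And>a i. a < N \<Longrightarrow> i < M \<Longrightarrow> f (a, i) \<in> B i"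
    and "\<And>i v. i < M \<Longrightarrow> card {a. a < N \<and> f (a, i) = v} \<le> 6 * d i"
    and "\<And>m W P. 0 < m \<Longrightarrow> m < M \<Longrightarrow> W \<noteq> {} \<Longrightarrow> W \<subseteq> {..<2 * N} \<Longrightarrow>
      card W * d m \<le> 2 * M\<^sup>2 * d (m - 1) * N \<Longrightarrow>
      P \<subseteq> (W \<inter> {..<N}) \<times> {..<m} \<Longrightarrow> f ` P \<subseteq> W \<Longrightarrow> card P < 2 * card W"
proof -
  define I where "I = {..<N} \<times> {..<M}"
  define \<Omega> where "\<Omega> = PiE I (\<lambda>x. B (snd x))"
  have finI: "finite I" by (simp add: I_def)
  have finB: "finite (B (snd x))" if "x \<in> I" for x using that finite_B by (auto simp: I_def)
  have B_pos: "0 < card (B i)" if "i < M" for i using card_B[OF that] N by (cases "card (B i)") auto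
  have card_B_real: "real (card (B i)) = real N / real (d i)" if "i < M" for i
    using card_B[OF that] d_pos[of i] by (simp add: field_simps flip: of_nat_mult)
  have fin\<Omega>: "finite \<Omega>" unfolding \<Omega>_def using finI finB by (intro finite_PiE)
  have "0 < card \<Omega>"
    unfolding \<Omega>_def using finI B_pos by (subst card_PiE) (auto intro!: prod_pos simp: I_def)
  then have \<Omega>_pos: "0 < real (card \<Omega>)" by simp
  have constrained: "real (card {g\<in>\<Omega>. \<forall>x\<in>P. g x \<in> S}) \<le> r ^ card P * real (card \<Omega>)"
    if "P \<subseteq> I" "\<And>x. x \<in> P \<Longrightarrow> real (card (S \<inter> B (snd x))) \<le> r * real (card (B (snd x)))" "0 \<le> r"
    for P S and r :: real
    unfolding \<Omega>_def using that finI finB by (intro card_PiE_constrained_le) auto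

  define \<T> where "\<T> i = {T. T \<subseteq> {..<N} \<and> card T = 6 * d i}" for i
  define E1 where "E1 i = (\<Union>v\<in>B i. \<Union>T\<in>\<T> i. {g\<in>\<Omega>. \<forall>x\<in>T \<times> {i}. g x \<in> {v}})" for i
  have E1: "real (card (E1 i)) \<le> 1 / (4 * M) * real (card \<Omega>)" if i: "i < M" for i
  proof -
    let ?t = "6 * d i"
    define c where "c = (real (d i) / N) ^ ?t * real (card \<Omega>)"
    have fin\<T>: "finite (\<T> i)" by (auto simp: \<T>_def)
    have "real (card {g\<in>\<Omega>. \<forall>x\<in>T \<times> {i}. g x \<in> {v}}) \<le> c" if "v \<in> B i" "T \<in> \<T> i" for v T
    proof -
      have "real (card {g\<in>\<Omega>. \<forall>x\<in>T \<times> {i}. g x \<in> {v}}) \<le> (real (d i) / N) ^ card (T \<times> {i}) * real (card \<Omega>)"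
        using that i N d_pos[of i]
        by (intro constrained) (auto simp: I_def \<T>_def card_B_real)
      then show ?thesis using that by (simp add: c_def \<T>_def card_cartesian_product)
    qed
    then have "real (card (E1 i)) \<le> (\<Sum>v\<in>B i. \<Sum>T\<in>\<T> i. c)"
      unfolding E1_def using finite_B[OF i] fin\<T> by (intro card_UN_le_sum) auto
    also have "\<dots> = real (card (B i)) * (real (N choose ?t) * c)"
      by (simp add: \<T>_def n_subsets)
    also have "\<dots> \<le> real N * (((1 / 2) ^ ?t) * real (card \<Omega>))"
    proof (rule mult_mono)
      show "real (card (B i)) \<le> real N"
        using card_B[OF i] d_pos[of i] by (metis mult_le_mono2 Suc_leI mult.right_neutral of_nat_le_iff One_nat_def)
      have "real (N choose ?t) \<le> (3 * real N / real ?t) ^ ?t"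
        using d_pos[of i] by (intro binomial_le_power) auto
      then have "real (N choose ?t) * c \<le> (3 * real N / real ?t) ^ ?t * c"
        by (intro mult_right_mono) (auto simp: c_def)
      also have "\<dots> = (3 * real N / real ?t * (real (d i) / N)) ^ ?t * real (card \<Omega>)"
        by (simp only: c_def power_mult_distrib mult.assoc)
      also have "\<dots> = (1 / 2) ^ ?t * real (card \<Omega>)"
      proof -
        have "3 * real N / real ?t * (real (d i) / N) = 1 / 2"
          using N d_pos[of i] by (simp add: field_simps)
        then show ?thesis by simp
      qed
      finally show "real (N choose ?t) * c \<le> (1 / 2) ^ ?t * real (card \<Omega>)" .
    qed (auto simp: c_def)
    also have "\<dots> \<le> 1 / (4 * M) * real (card \<Omega>)"
    proof -
      have "real (4 * M * N) \<le> real (2 ^ ?t)" using d_large[OF i] by (simp only: of_nat_le_iff)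
      then have "real N * (1 / 2) ^ ?t \<le> 1 / (4 * M)"
        using i by (simp add: field_simps power_divide)
      then have "real N * (1 / 2) ^ ?t * real (card \<Omega>) \<le> 1 / (4 * M) * real (card \<Omega>)"
        by (rule mult_right_mono) simp
      then show ?thesis by (simp only: mult.assoc)
    qed
    finally show ?thesis .
  qed

  define \<W> where "\<W> m = {W. W \<noteq> {} \<and> W \<subseteq> {..<2 * N} \<and> card W * d m \<le> 2 * M\<^sup>2 * d (m - 1) * N}" for m
  define \<P> :: "nat \<Rightarrow> nat set \<Rightarrow> (nat \<times> nat) set set"
    where "\<P> m W = {P. P \<subseteq> (W \<inter> {..<N}) \<times> {..<m} \<and> card P = 2 * card W}" for m W
  define E2 where "E2 m = (\<Union>W\<in>\<W> m. \<Union>P\<in>\<P> m W. {g\<in>\<Omega>. \<forall>x\<in>P. g x \<in> W})" for m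
  have E2: "real (card (E2 m)) \<le> 1 / (3 * M) * real (card \<Omega>)" if m: "0 < m" "m < M" for m
  proof -
    \<comment> \<open>The base of the geometric series over the size of \<open>W\<close>. Its sum is
      at most \<open>1 / (3 * M)\<close>, so all levels together fail with weight at most 1/3, next
      to 1/4 for the first kind of failure.\<close>
    define q where "q = 1 / (4 * real M)"
    have q: "0 \<le> q" "q \<le> 1 / 4" using m by (auto simp: q_def)
    \<comment> \<open>Bounds the probability that an endpoint falls into a set of size
      \<open>w\<close>: in layer \<open>i\<close> it is at most \<open>w * d i / N\<close>, and the
      edges considered lie in layers up to \<open>m - 1\<close>.\<close>
    define r where "r w = real w * real (d (m - 1)) / N" for w
    have fin\<W>: "finite (\<W> m)" by (auto simp: \<W>_def)
    have \<W>D: "finite W" "0 < card W" "card W \<le> 2 * N" if "W \<in> \<W> m" for W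
      using that card_mono[of "{..<2 * N}" W] finite_subset[of W "{..<2 * N}"]
      by (auto simp: \<W>_def card_gt_0_iff)
    have one: "real (card (\<Union>P\<in>\<P> m W. {g\<in>\<Omega>. \<forall>x\<in>P. g x \<in> W}))
        \<le> (2 ^ M * (r (card W))\<^sup>2) ^ card W * real (card \<Omega>)" if W: "W \<in> \<W> m" for W
    proof -
      let ?w = "card W"
      have fin: "finite ((W \<inter> {..<N}) \<times> {..<m})" using \<W>D[OF W] by simp
      have "\<P> m W \<subseteq> Pow ((W \<inter> {..<N}) \<times> {..<m})" by (auto simp: \<P>_def)
      moreover from this have fin\<P>: "finite (\<P> m W)" by (rule finite_subset) (use fin in simp)
      ultimately have "card (\<P> m W) \<le> card (Pow ((W \<inter> {..<N}) \<times> {..<m}))"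
        using fin by (intro card_mono) simp_all
      also have "\<dots> = 2 ^ (card (W \<inter> {..<N}) * m)" using fin by (simp add: card_Pow card_cartesian_product)
      also have "\<dots> \<le> 2 ^ (?w * M)"
        using m \<W>D[OF W] by (intro power_increasing mult_mono card_mono) auto
      finally have "real (card (\<P> m W)) \<le> real (2 ^ (?w * M))" by (simp only: of_nat_le_iff)
      then have c\<P>: "real (card (\<P> m W)) \<le> (2 ^ M) ^ ?w" by (simp add: mult.commute flip: power_mult)
      have "real (card {g\<in>\<Omega>. \<forall>x\<in>P. g x \<in> W}) \<le> r ?w ^ card P * real (card \<Omega>)" if P: "P \<in> \<P> m W" for P
      proof (rule constrained)
        show "P \<subseteq> I" using P m by (auto simp: \<P>_def I_def)
        fix x assume x: "x \<in> P"
        have i: "snd x < m" "snd x < M" "snd x \<le> m - 1" using x P m by (auto simp: \<P>_def)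
        have "real (card (W \<inter> B (snd x))) \<le> real ?w * 1"
          using \<W>D[OF W] by (auto intro: card_mono)
        also have "\<dots> \<le> real ?w * (real (d (m - 1)) / real (d (snd x)))"
          using d_mono[OF i(3)] d_pos[of "snd x"] by (intro mult_left_mono) auto
        also have "\<dots> = r ?w * real (card (B (snd x)))"
          using N by (simp add: r_def card_B_real[OF i(2)])
        finally show "real (card (W \<inter> B (snd x))) \<le> r ?w * real (card (B (snd x)))" .
      qed (simp add: r_def)
      then have "real (card (\<Union>P\<in>\<P> m W. {g\<in>\<Omega>. \<forall>x\<in>P. g x \<in> W}))
          \<le> (\<Sum>P\<in>\<P> m W. r ?w ^ card P * real (card \<Omega>))"
        using fin\<P> by (intro card_UN_le_sum)
      also have "\<dots> = real (card (\<P> m W)) * ((r ?w ^ (2 * ?w)) * real (card \<Omega>))"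
        by (simp add: \<P>_def)
      also have "\<dots> \<le> (2 ^ M) ^ ?w * ((r ?w ^ (2 * ?w)) * real (card \<Omega>))"
        using c\<P> by (intro mult_right_mono) (auto simp: r_def)
      also have "\<dots> = (2 ^ M * (r ?w)\<^sup>2) ^ ?w * real (card \<Omega>)"
        by (simp add: power_mult_distrib power_mult)
      finally show ?thesis .
    qed
    have "real (card (E2 m)) \<le> (\<Sum>W\<in>\<W> m. (2 ^ M * (r (card W))\<^sup>2) ^ card W * real (card \<Omega>))"
      unfolding E2_def using fin\<W> one by (rule card_UN_le_sum)
    also have "\<dots> = (\<Sum>w\<in>{1..2 * N}. \<Sum>W\<in>{W\<in>\<W> m. card W = w}.
        (2 ^ M * (r (card W))\<^sup>2) ^ card W * real (card \<Omega>))"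
      using fin\<W> \<W>D by (intro sum.group[symmetric]) (auto simp: Suc_le_eq)
    also have "\<dots> \<le> (\<Sum>w\<in>{1..2 * N}. q ^ w * real (card \<Omega>))"
    proof (intro sum_mono)
      fix w assume w: "w \<in> {1..2 * N}"
      let ?\<W>w = "{W\<in>\<W> m. card W = w}"
      show "(\<Sum>W\<in>?\<W>w. (2 ^ M * (r (card W))\<^sup>2) ^ card W * real (card \<Omega>)) \<le> q ^ w * real (card \<Omega>)"
      proof (cases "?\<W>w = {}")
        case True
        then show ?thesis using q by (simp only: sum.empty) simp
      next
        case False
        then have "w * d m \<le> 2 * M\<^sup>2 * d (m - 1) * N" by (auto simp: \<W>_def)
        then have "real (w * d m) \<le> real (2 * M\<^sup>2 * d (m - 1) * N)" by (simp only: of_nat_le_iff)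
        then have w_small: "real w * d m \<le> 2 * (real M)\<^sup>2 * d (m - 1) * N" by simp
        have "card ?\<W>w \<le> card {W. W \<subseteq> {..<2 * N} \<and> card W = w}"
          by (intro card_mono) (auto simp: \<W>_def)
        also have "\<dots> = (2 * N) choose w" by (simp add: n_subsets)
        finally have "real (card ?\<W>w) \<le> real ((2 * N) choose w)" by simp
        also have "\<dots> \<le> (3 * real (2 * N) / real w) ^ w" using w by (intro binomial_le_power) auto
        finally have c\<W>: "real (card ?\<W>w) \<le> (3 * real (2 * N) / real w) ^ w" .
        have "(\<Sum>W\<in>?\<W>w. (2 ^ M * (r (card W))\<^sup>2) ^ card W * real (card \<Omega>))
            = real (card ?\<W>w) * ((2 ^ M * (r w)\<^sup>2) ^ w * real (card \<Omega>))" by simp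
        also have "\<dots> \<le> (3 * real (2 * N) / real w) ^ w * ((2 ^ M * (r w)\<^sup>2) ^ w * real (card \<Omega>))"
          using c\<W> by (intro mult_right_mono) auto
        also have "\<dots> = (3 * real (2 * N) / real w * (2 ^ M * (r w)\<^sup>2)) ^ w * real (card \<Omega>)"
          by (simp only: mult.assoc power_mult_distrib[of "3 * real (2 * N) / real w"])
        also have "\<dots> \<le> q ^ w * real (card \<Omega>)"
        proof (intro mult_right_mono power_mono)
          \<comment> \<open>The choice of \<open>W\<close> costs \<open>6 * N / w\<close> per
            vertex, whereas two edges per vertex gain the square of \<open>w * ?d / N\<close>; one
            factor \<open>w / N\<close> therefore remains. The size condition on \<open>W\<close>
            bounds it at the cost of a third factor \<open>?d\<close>, hence the cube in
            \<open>d_growth\<close>.\<close>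
          let ?d = "real (d (m - 1))"
          have "real (48 * M ^ 3 * 2 ^ M * d (m - 1) ^ 3) \<le> real (d m)"
            using d_growth[OF m] by (simp only: of_nat_le_iff)
          then have "real w * (48 * real M ^ 3 * 2 ^ M * ?d ^ 3) \<le> real w * d m"
            by (intro mult_left_mono) auto
          also note w_small
          finally have "(24 * real w * real M * 2 ^ M * ?d\<^sup>2) * (2 * (real M)\<^sup>2 * ?d) \<le> N * (2 * (real M)\<^sup>2 * ?d)"
            by (simp add: power2_eq_square power3_eq_cube mult_ac)
          then have key: "24 * real w * real M * 2 ^ M * ?d\<^sup>2 \<le> N"
            using m d_pos[of "m - 1"] by (subst (asm) mult_le_cancel_right) auto
          have "3 * real (2 * N) / real w * (2 ^ M * (r w)\<^sup>2) = 6 * real w * 2 ^ M * ?d\<^sup>2 / N"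
            using w N by (simp add: r_def power2_eq_square field_simps)
          also have "\<dots> \<le> q"
            using key N m by (simp add: q_def field_simps)
          finally show "3 * real (2 * N) / real w * (2 ^ M * (r w)\<^sup>2) \<le> q" .
        qed auto
        finally show ?thesis .
      qed
    qed
    also have "\<dots> = (\<Sum>w\<in>{1..2 * N}. q ^ w) * real (card \<Omega>)" by (rule sum_distrib_right[symmetric])
    also have "\<dots> \<le> (4 / 3 * q) * real (card \<Omega>)"
      using q by (intro mult_right_mono sum_powers_le) auto
    also have "4 / 3 * q = 1 / (3 * M)" by (simp add: q_def)
    finally show ?thesis .
  qed

  have "real (card ((\<Union>i<M. E1 i) \<union> (\<Union>m\<in>{0<..<M}. E2 m)))
      \<le> real (card (\<Union>i<M. E1 i)) + real (card (\<Union>m\<in>{0<..<M}. E2 m))"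
    using card_Un_le by (simp flip: of_nat_add)
  also have "\<dots> \<le> (\<Sum>i<M. 1 / (4 * M) * real (card \<Omega>)) + (\<Sum>m\<in>{0<..<M}. 1 / (3 * M) * real (card \<Omega>))"
    using E1 E2 by (intro add_mono card_UN_le_sum) auto
  also have "\<dots> \<le> (\<Sum>i<M. 1 / (4 * M) * real (card \<Omega>)) + (\<Sum>m<M. 1 / (3 * M) * real (card \<Omega>))"
    by (intro add_left_mono sum_mono2) auto
  also have "\<dots> \<le> 1 / 4 * real (card \<Omega>) + 1 / 3 * real (card \<Omega>)"
    by simp
  also have "\<dots> < real (card \<Omega>)" using \<Omega>_pos by simp
  finally have "card ((\<Union>i<M. E1 i) \<union> (\<Union>m\<in>{0<..<M}. E2 m)) < card \<Omega>" by simp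
  moreover have "(\<Union>i<M. E1 i) \<union> (\<Union>m\<in>{0<..<M}. E2 m) \<subseteq> \<Omega>"
    by (auto simp: E1_def E2_def)
  then have "finite ((\<Union>i<M. E1 i) \<union> (\<Union>m\<in>{0<..<M}. E2 m))"
    using fin\<Omega> by (rule finite_subset)
  ultimately have "\<not> \<Omega> \<subseteq> (\<Union>i<M. E1 i) \<union> (\<Union>m\<in>{0<..<M}. E2 m)"
    using card_mono[of _ \<Omega>] by (meson not_le)
  then obtain f where "f \<in> \<Omega>" "f \<notin> (\<Union>i<M. E1 i)" "f \<notin> (\<Union>m\<in>{0<..<M}. E2 m)" by blast
  then have f: "f \<in> \<Omega>" "\<And>i. i < M \<Longrightarrow> f \<notin> E1 i" "\<And>m. 0 < m \<Longrightarrow> m < M \<Longrightarrow> f \<notin> E2 m" by auto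
  show thesis
  proof (rule that[of f])
    show mem: "f (a, i) \<in> B i" if "a < N" "i < M" for a i
      using f(1) that by (auto simp: \<Omega>_def I_def PiE_iff)
    show "card {a. a < N \<and> f (a, i) = v} \<le> 6 * d i" if i: "i < M" for i v
    proof (rule ccontr)
      assume "\<not> ?thesis"
      then have "6 * d i \<le> card {a. a < N \<and> f (a, i) = v}" by simp
      then obtain T where T: "T \<subseteq> {a. a < N \<and> f (a, i) = v}" "card T = 6 * d i"
        by (rule obtain_subset_with_card_n)
      then obtain a where "a \<in> T" using d_pos[of i] by fastforce
      then have "v \<in> B i" using T(1) mem[of a i] i by auto
      moreover have "T \<in> \<T> i" using T by (auto simp: \<T>_def)
      ultimately have "f \<in> E1 i" using T(1) f(1) unfolding E1_def by blast
      with f(2)[OF i] show False by simp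
    qed
    show "card P < 2 * card W"
      if "0 < m" "m < M" "W \<noteq> {}" "W \<subseteq> {..<2 * N}" "card W * d m \<le> 2 * M\<^sup>2 * d (m - 1) * N"
        "P \<subseteq> (W \<inter> {..<N}) \<times> {..<m}" "f ` P \<subseteq> W" for m W P
    proof (rule ccontr)
      assume "\<not> ?thesis"
      then have "2 * card W \<le> card P" by simp
      then obtain P' where P': "P' \<subseteq> P" "card P' = 2 * card W"
        by (rule obtain_subset_with_card_n)
      have "W \<in> \<W> m" using that by (simp add: \<W>_def)
      moreover have "P' \<in> \<P> m W" using P' that by (auto simp: \<P>_def)
      moreover have "f \<in> {g\<in>\<Omega>. \<forall>x\<in>P'. g x \<in> W}" using f(1) P'(1) that(7) by auto
      ultimately have "f \<in> E2 m" unfolding E2_def by blast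
      with f(3)[OF that(1,2)] show False by simp
    qed
  qed
qed

section \<open>The graph of a layered structure\<close>

context layered
begin

abbreviation "I \<equiv> {..<N} \<times> {..<M}"

definition edge :: "nat \<times> nat \<Rightarrow> nat \<times> nat" where
  "edge q = (fst q, f q)"

text \<open>The vertices from \<open>2 * N\<close> on are isolated. They pad the graph to any
  prescribed order \<open>n\<close>, since \<open>N\<close> takes only special values.\<close>

definition graph_on :: "nat \<Rightarrow> nat pair_pre_digraph" where
  "graph_on n = \<lparr>pverts = {..<n}, parcs = edge ` I \<union> prod.swap ` edge ` I\<rparr>"

lemma fst_less: "q \<in> I \<Longrightarrow> fst q < N"
  by auto

lemma f_bounds: "q \<in> I \<Longrightarrow> N \<le> f q \<and> f q < 2 * N"
  using f_mem[of "fst q" "snd q"] B_ge[of "snd q" "f q"] B_less[of "snd q" "f q"] by auto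

text \<open>Disjointness of the layers makes the layer recoverable from the endpoint. Hence there
  are no parallel edges, and edges can be counted by their indices.\<close>

lemma edge_eqD:
  assumes "fst q = fst q'" "f q = f q'" "q \<in> I" "q' \<in> I"
  shows "q = q'"
  using f_level[OF assms(2-4)] assms(1) by (simp add: prod_eq_iff)

lemma inj_edge: "inj_on edge I"
  by (rule inj_onI) (simp add: edge_def edge_eqD)

lemma pair_graph_graph_on:
  assumes "2 * N \<le> n"
  shows "pair_graph (graph_on n)"
proof
  show "fst e \<in> pverts (graph_on n)" "snd e \<in> pverts (graph_on n)" "fst e \<noteq> snd e"
    if "e \<in> parcs (graph_on n)" for e
    using that assms fst_less f_bounds by (fastforce simp: graph_on_def edge_def)+
  show "symmetric (with_proj (graph_on n))"
    by (auto simp: symmetric_def sym_def graph_on_def)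
qed (auto simp: graph_on_def)

text \<open>A subgraph is determined on its edges by an index set \<open>Q\<close>, to which
  \<open>layered_form_le\<close> applies with \<open>D\<close> the maximum degree; 144 is the square
  of 12.\<close>

lemma spectrally_degenerate_graph_on:
  assumes n: "2 * N \<le> n"
  shows "spectrally_degenerate 144 (graph_on n)"
  unfolding spectrally_degenerate_def
proof (intro allI impI)
  fix H assume "nonempty_subgraph H (graph_on n)"
  then have H: "pair_graph H" "pverts H \<noteq> {}" "parcs H \<subseteq> parcs (graph_on n)"
    by (auto simp: nonempty_subgraph_def subgraph_def)
  interpret H: pair_graph H by fact
  define Q where "Q = {q\<in>I. edge q \<in> parcs H}"
  have QI: "Q \<subseteq> I" by (auto simp: Q_def)
  have finQ: "finite Q" using QI by (rule finite_subset) auto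
  have injQ: "inj_on edge Q" using inj_edge QI by (rule inj_on_subset)
  have sw: "prod.swap e \<in> parcs H" if "e \<in> parcs H" for e
    using that H.arcs_symmetric by (cases e) auto
  have parcs_H: "parcs H = edge ` Q \<union> prod.swap ` edge ` Q"
  proof
    show "parcs H \<subseteq> edge ` Q \<union> prod.swap ` edge ` Q"
    proof
      fix e assume e: "e \<in> parcs H"
      then consider q where "q \<in> I" "e = edge q" | q where "q \<in> I" "e = prod.swap (edge q)"
        using H(3) by (auto simp: graph_on_def)
      then show "e \<in> edge ` Q \<union> prod.swap ` edge ` Q"
      proof cases
        case 1
        then show ?thesis using e by (auto simp: Q_def)
      next
        case 2
        then have "edge q \<in> parcs H" using sw[OF e] by simp
        then have "q \<in> Q" using 2(1) by (simp add: Q_def)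
        then show ?thesis using 2(2) by blast
      qed
    qed
    show "edge ` Q \<union> prod.swap ` edge ` Q \<subseteq> parcs H" using sw unfolding Q_def by blast
  qed
  let ?D = "max_degree H"
  have degA: "card {q\<in>Q. fst q = u} \<le> ?D" for u
  proof (cases "{q\<in>Q. fst q = u} = {}")
    case True
    show ?thesis unfolding True by simp
  next
    case False
    then obtain q where "q \<in> Q" "fst q = u" by blast
    then have "(u, f q) \<in> parcs H" by (auto simp: Q_def edge_def)
    then have "u \<in> pverts H" by (rule H.wellformed'(1))
    have "card {q\<in>Q. fst q = u} = card (edge ` {q\<in>Q. fst q = u})"
      by (intro card_image[symmetric] inj_on_subset[OF injQ]) auto
    also have "\<dots> \<le> card {e\<in>parcs H. fst e = u}"
      using H.pair_finite_arcs parcs_H by (intro card_mono) (auto simp: edge_def)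
    also have "\<dots> \<le> ?D" using H.pair_finite_verts \<open>u \<in> pverts H\<close> by (rule max_degree_ge)
    finally show ?thesis .
  qed
  have degB: "card {q\<in>Q. f q = v} \<le> ?D" for v
  proof (cases "{q\<in>Q. f q = v} = {}")
    case True
    show ?thesis unfolding True by simp
  next
    case False
    then obtain q where "q \<in> Q" "f q = v" by blast
    then have "(fst q, v) \<in> parcs H" by (simp add: Q_def edge_def)
    then have "v \<in> pverts H" by (rule H.wellformed'(2))
    have "card {q\<in>Q. f q = v} = card (edge ` {q\<in>Q. f q = v})"
      by (intro card_image[symmetric] inj_on_subset[OF injQ]) auto
    also have "\<dots> = card (prod.swap ` edge ` {q\<in>Q. f q = v})"
      by (intro card_image[symmetric]) simp
    also have "\<dots> \<le> card {e\<in>parcs H. fst e = v}"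
      using H.pair_finite_arcs parcs_H by (intro card_mono) (auto simp: edge_def)
    also have "\<dots> \<le> ?D" using H.pair_finite_verts \<open>v \<in> pverts H\<close> by (rule max_degree_ge)
    finally show ?thesis .
  qed
  have V: "fst ` Q \<subseteq> pverts H" "f ` Q \<subseteq> pverts H"
    using H.wellformed' by (auto simp: Q_def edge_def)
  have "graph_spectral_radius H \<le> 12 * sqrt ?D"
  proof (rule graph_spectral_radius_le[OF H(1,2)])
    fix x :: "nat \<Rightarrow> real"
    have disj: "edge ` Q \<inter> prod.swap ` edge ` Q = {}"
      using QI fst_less f_bounds by (fastforce simp: edge_def)
    have "(\<Sum>e\<in>parcs H. x (fst e) * x (snd e))
        = (\<Sum>e\<in>edge ` Q. x (fst e) * x (snd e)) + (\<Sum>e\<in>prod.swap ` edge ` Q. x (fst e) * x (snd e))"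
      unfolding parcs_H using finQ disj by (intro sum.union_disjoint) auto
    also have "(\<Sum>e\<in>prod.swap ` edge ` Q. x (fst e) * x (snd e)) = (\<Sum>e\<in>edge ` Q. x (fst e) * x (snd e))"
      by (subst sum.reindex) (auto simp: mult.commute)
    also have "(\<Sum>e\<in>edge ` Q. x (fst e) * x (snd e)) = (\<Sum>q\<in>Q. x (fst q) * x (f q))"
      using injQ by (subst sum.reindex) (auto simp: edge_def)
    finally have sum: "(\<Sum>e\<in>parcs H. x (fst e) * x (snd e)) = 2 * (\<Sum>q\<in>Q. x (fst q) * x (f q))"
      by simp
    show "(\<Sum>e\<in>parcs H. x (fst e) * x (snd e)) \<le> 12 * sqrt ?D * (\<Sum>v\<in>pverts H. (x v)\<^sup>2)"
    proof (cases "?D = 0")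
      case True
      have "Q = {}"
      proof (rule ccontr)
        assume "Q \<noteq> {}"
        then obtain q where "q \<in> Q" by auto
        then have "card {q} \<le> card {q'\<in>Q. fst q' = fst q}"
          using finQ by (intro card_mono) auto
        then have "1 \<le> card {q'\<in>Q. fst q' = fst q}" by simp
        with degA[of "fst q"] True show False by linarith
      qed
      then show ?thesis unfolding sum using True by simp
    next
      case False
      then show ?thesis unfolding sum
        using H.pair_finite_verts V by (intro layered_form_le QI degA degB) auto
    qed
  qed
  also have "12 * sqrt ?D = sqrt (144 * real ?D)" by (simp add: real_sqrt_mult)
  finally show "graph_spectral_radius H \<le> sqrt (144 * real ?D)" .
qed

text \<open>A vertex set \<open>U\<close> maximizing \<open>e(U) - (k + 1) |U|\<close> induces a subgraph of minimum degree at
  least \<open>k + 1\<close>.\<close>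

lemma k_degenerate_graph_on:
  assumes n: "2 * N \<le> n" and k: "k_degenerate k (graph_on n)"
  shows "M \<le> 2 * k + 2"
proof (rule ccontr)
  assume "\<not> ?thesis"
  then have kM: "2 * k + 2 < M" by simp
  interpret G: pair_graph "graph_on n" using n by (rule pair_graph_graph_on)
  define F where "F U = {q\<in>I. fst q \<in> U \<and> f q \<in> U}" for U
  have finF: "finite (F U)" for U by (rule finite_subset[of _ I]) (auto simp: F_def)
  define \<phi> where "\<phi> U = int (card (F U)) - int ((k + 1) * card U)" for U
  define m where "m = Max (\<phi> ` Pow {..<2 * N})"
  have "m \<in> \<phi> ` Pow {..<2 * N}" unfolding m_def by (intro Max_in) auto
  then obtain U where U: "U \<subseteq> {..<2 * N}" "\<phi> U = m" by auto
  have \<phi>_le: "\<phi> U' \<le> \<phi> U" if "U' \<subseteq> {..<2 * N}" for U'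
    unfolding U(2) m_def using that by (intro Max_ge) auto
  have finU: "finite U" using U(1) by (rule finite_subset) auto
  \<comment> \<open>All \<open>N * M\<close> edges live on \<open>2 * N\<close> vertices, so this
    set has a positive value. The empty set has value 0, so the maximizer is nonempty.\<close>
  have "F {..<2 * N} = I" using f_bounds by (auto simp: F_def)
  then have "\<phi> {..<2 * N} = int N * (int M - int (2 * k + 2))"
    by (simp add: \<phi>_def card_cartesian_product algebra_simps)
  also have "\<dots> > 0" using kM N by simp
  finally have "\<phi> U > 0" using \<phi>_le[of "{..<2 * N}"] by simp
  then have "U \<noteq> {}" by (auto simp: \<phi>_def F_def)
  define H where "H = \<lparr>pverts = U, parcs = {e\<in>parcs (graph_on n). fst e \<in> U \<and> snd e \<in> U}\<rparr>"
  have H: "pair_graph H"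
  proof
    show "symmetric (with_proj H)"
      using G.arcs_symmetric by (auto simp: symmetric_def sym_def H_def)
    show "fst e \<noteq> snd e" if "e \<in> parcs H" for e
      using that G.no_loops'[of "fst e" "snd e"] by (auto simp: H_def)
  qed (use finU G.pair_finite_arcs in \<open>auto simp: H_def\<close>)
  then interpret H: pair_graph H .
  have "U \<subseteq> {..<n}" using U(1) n by auto
  then have "subgraph (with_proj H) (with_proj (graph_on n))"
    by (intro subgraphI H.wf_digraph_axioms G.wf_digraph_axioms) (auto simp: H_def graph_on_def)
  then have "nonempty_subgraph H (graph_on n)"
    using H \<open>U \<noteq> {}\<close> by (auto simp: nonempty_subgraph_def H_def)
  with k obtain v where v: "v \<in> U" "out_degree (with_proj H) v \<le> k"
    by (auto simp: k_degenerate_def H_def)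
  have "\<phi> (U - {v}) \<le> \<phi> U" using U(1) by (intro \<phi>_le) auto
  moreover have "card U = Suc (card (U - {v}))" using card_Suc_Diff1[OF finU v(1)] by simp
  ultimately have big: "card (F (U - {v})) + (k + 1) \<le> card (F U)"
    by (simp add: \<phi>_def algebra_simps)
  define X where "X = F U - F (U - {v})"
  have "card (F U) - card (F (U - {v})) = card X"
    unfolding X_def using finF by (intro card_Diff_subset[symmetric]) (auto simp: F_def)
  with big have "k < card X" by simp
  also have "card X \<le> card (out_arcs (with_proj H) v)"
  proof (rule card_inj_on_le)
    \<comment> \<open>Orients every edge lost with \<open>v\<close> away from \<open>v\<close>. The
      left end is below \<open>N\<close> and the right end is not, so the edge can be recovered from
      its orientation.\<close>
    let ?h = "\<lambda>q. if fst q = v then edge q else prod.swap (edge q)"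
    have X: "q \<in> I" "fst q = v \<or> f q = v" "fst q \<in> U" "f q \<in> U" if "q \<in> X" for q
      using that by (auto simp: X_def F_def)
    show "inj_on ?h X"
    proof (rule inj_onI)
      fix q q' assume q: "q \<in> X" "q' \<in> X" "?h q = ?h q'"
      have "fst q < N" "N \<le> f q" "fst q' < N" "N \<le> f q'"
        using X(1)[OF q(1)] X(1)[OF q(2)] fst_less f_bounds by auto
      then have "edge q = edge q'" using q(3) by (auto simp: edge_def split: if_splits)
      then show "q = q'" using inj_onD[OF inj_edge] X(1) q(1,2) by blast
    qed
    show "?h ` X \<subseteq> out_arcs (with_proj H) v"
    proof
      fix e assume "e \<in> ?h ` X"
      then obtain q where q: "q \<in> X" "e = ?h q" by auto
      then have "e \<in> parcs (graph_on n)" using X(1)[OF q(1)] by (auto simp: graph_on_def)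
      moreover have "fst e = v" "snd e \<in> U" using q X[OF q(1)] by (auto simp: edge_def)
      ultimately show "e \<in> out_arcs (with_proj H) v" using v(1) by (simp add: H_def)
    qed
    show "finite (out_arcs (with_proj H) v)" by (rule H.finite_out_arcs)
  qed
  finally show False using v(2) by (simp add: out_degree_def)
qed

text \<open>The number of arcs is a crude degeneracy bound, so the \<open>LEAST\<close> is attained
  and the preceding estimate applies to it.\<close>

lemma degeneracy_graph_on:
  assumes n: "2 * N \<le> n"
  shows "M \<le> 2 * degeneracy (graph_on n) + 2"
proof -
  interpret G: pair_graph "graph_on n" using n by (rule pair_graph_graph_on)
  have "k_degenerate (card (parcs (graph_on n))) (graph_on n)"
    unfolding k_degenerate_def
  proof (intro allI impI)
    fix H assume H: "nonempty_subgraph H (graph_on n)"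
    then have sub: "parcs H \<subseteq> parcs (graph_on n)" by (auto simp: nonempty_subgraph_def subgraph_def)
    from H obtain v where v: "v \<in> pverts H" by (auto simp: nonempty_subgraph_def)
    have "out_degree (with_proj H) v \<le> card (parcs (graph_on n))"
      unfolding out_degree_def using sub G.pair_finite_arcs
      by (intro card_mono) (auto simp: out_arcs_def)
    with v show "\<exists>v\<in>pverts H. out_degree (with_proj H) v \<le> card (parcs (graph_on n))" by blast
  qed
  then have "k_degenerate (degeneracy (graph_on n)) (graph_on n)"
    unfolding degeneracy_def by (rule LeastI)
  then show ?thesis by (rule k_degenerate_graph_on[OF n])
qed

text \<open>The lower bound, read off at vertex 0 with its one edge per layer, will make the
  iterated logarithms of the maximum degree positive. The upper bound reduces the estimate in the
  maximum degree to the one in \<open>n\<close>.\<close>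

lemma max_degree_graph_on:
  assumes n: "2 * N \<le> n"
  shows "M \<le> max_degree (graph_on n)" "max_degree (graph_on n) < n"
proof -
  interpret G: pair_graph "graph_on n" using n by (rule pair_graph_graph_on)
  have "M = card ((\<lambda>i. edge (0, i)) ` {..<M})"
    using inj_edge N by (subst card_image) (auto simp: inj_on_def)
  also have "\<dots> \<le> card {e\<in>parcs (graph_on n). fst e = 0}"
    using G.pair_finite_arcs N
    by (intro card_mono) (auto simp: graph_on_def edge_def intro!: UnI1 image_eqI[of _ _ "(0, _)"])
  also have "\<dots> \<le> max_degree (graph_on n)"
    using n N by (intro max_degree_ge) (auto simp: graph_on_def)
  finally show "M \<le> max_degree (graph_on n)" .
  have "0 \<in> pverts (graph_on n)" using n N by (simp add: graph_on_def)
  then have "pverts (graph_on n) \<noteq> {}" by blast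
  from max_degree_less[OF G.pair_graph this] show "max_degree (graph_on n) < n"
    by (simp add: graph_on_def)
qed

text \<open>From 4 on, \<open>(M - 2) / 2\<close> is at least \<open>M / 4\<close>, and 576 is 4
  times 144.\<close>

lemma ratio_graph_on:
  assumes n: "2 * N \<le> n" and M4: "4 \<le> M"
  shows "real M / 576 \<le> real (degeneracy (graph_on n)) / spectral_degeneracy (graph_on n)"
proof -
  have "edge (0, 0) \<in> parcs (graph_on n)" using N M by (auto simp: graph_on_def)
  then have "parcs (graph_on n) \<noteq> {}" by auto
  note sd = spectral_degeneracy_bounds[OF pair_graph_graph_on[OF n] this _
      spectrally_degenerate_graph_on[OF n]]
  have "real M / 4 \<le> real (degeneracy (graph_on n))"
    using degeneracy_graph_on[OF n] M4 by linarith
  then have "(real M / 4) / 144 \<le> real (degeneracy (graph_on n)) / spectral_degeneracy (graph_on n)"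
    using sd by (intro frac_le) auto
  then show ?thesis by simp
qed

end

section \<open>Choice of the degrees and the layers\<close>

lemma exists_layered:
  assumes M: "2 \<le> M"
  shows "\<exists>d B f. layered (2 ^ (10 * M * 4 ^ M)) M d B f"
proof -
  \<comment> \<open>\<open>N\<close> equals \<open>d M\<close>, so every \<open>d i\<close> with
    \<open>i < M\<close> divides it.\<close>
  define N :: nat where "N = 2 ^ (10 * M * 4 ^ M)"
  define d :: "nat \<Rightarrow> nat" where "d i = 2 ^ (10 * M * 4 ^ i)" for i
  define b where "b = N div d 0"
  \<comment> \<open>Layer \<open>i\<close> starts a slot of length \<open>b\<close>, the size of the
    largest layer. All \<open>M\<close> slots fit between \<open>N\<close> and \<open>2 * N\<close>
    because \<open>M\<close> is at most \<open>d 0\<close>.\<close>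
  define B where "B i = {N + i * b..<N + i * b + N div d i}" for i
  have N: "0 < N" by (simp add: N_def)
  have d_pos: "0 < d i" for i by (simp add: d_def)
  have M_less: "M < 2 ^ M" by (rule less_exp)
  have d_mono: "d i \<le> d j" if "i \<le> j" for i j
    unfolding d_def using that by (intro power_increasing mult_left_mono) auto
  have d_Suc: "d (Suc i) = d i ^ 4" for i
    by (simp add: d_def mult_ac flip: power_mult)
  have d0: "d 0 \<le> d i" for i by (rule d_mono) simp
  have d0_M: "2 ^ (10 * M) = d 0" by (simp add: d_def)
  have d_dvd: "d i dvd N" if "i < M" for i
    unfolding N_def d_def using that by (intro le_imp_power_dvd mult_left_mono power_increasing) auto
  have card_B: "card (B i) * d i = N" if "i < M" for i
    using d_dvd[OF that] by (simp add: B_def)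
  have len: "N div d i \<le> b" for i
    unfolding b_def using d0 d_pos by (intro div_le_mono2) auto
  have BD: "N + i * b \<le> v \<and> v < N + Suc i * b" if "v \<in> B i" for v i
    using that len[of i] by (auto simp: B_def)
  have "M * b \<le> N"
  proof -
    have "M \<le> 2 ^ M" using M_less by simp
    also have "\<dots> \<le> 2 ^ (10 * M)" by (rule power_increasing) auto
    finally have "M \<le> d 0" by (simp only: d0_M)
    then have "M * b \<le> d 0 * b" by (rule mult_right_mono) simp
    also have "\<dots> \<le> N" by (simp add: b_def)
    finally show ?thesis .
  qed
  have B_less: "v < 2 * N" if "i < M" "v \<in> B i" for i v
  proof -
    have "Suc i * b \<le> M * b" using that(1) by (intro mult_right_mono) auto
    then show ?thesis using BD[OF that(2)] \<open>M * b \<le> N\<close> by linarith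
  qed
  have disj: "B i \<inter> B j = {}" if "i < j" for i j
  proof -
    have "Suc i * b \<le> j * b" using that by (intro mult_right_mono) auto
    then show ?thesis using BD[of _ i] BD[of _ j] by (fastforce simp: disjoint_iff)
  qed
  \<comment> \<open>Of the four factors in \<open>d m = d (m - 1) ^ 4\<close>, three supply the cube
    and the last, at least \<open>2 ^ (10 * M)\<close>, absorbs the terms in
    \<open>M\<close>.\<close>
  have growth: "48 * M ^ 3 * 2 ^ M * d (m - 1) ^ 3 \<le> d m" if "0 < m" for m
  proof -
    have "48 * M ^ 3 * 2 ^ M \<le> 2 ^ 6 * (2 ^ M) ^ 3 * 2 ^ M"
      using M_less by (intro mult_mono power_mono) auto
    also have "\<dots> = (2::nat) ^ (6 + M * 3 + M)" by (simp only: power_add power_mult)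
    also have "\<dots> \<le> 2 ^ (10 * M)" using M by (intro power_increasing) auto
    also have "\<dots> \<le> d (m - 1)" unfolding d0_M by (rule d0)
    finally have "48 * M ^ 3 * 2 ^ M * d (m - 1) ^ 3 \<le> d (m - 1) * d (m - 1) ^ 3"
      by (rule mult_right_mono) simp
    also have "\<dots> = d m" using d_Suc[of "m - 1"] that by (simp add: power3_eq_cube power4_eq_xxxx)
    finally show ?thesis .
  qed
  \<comment> \<open>Even the smallest degree, \<open>d 0 = 1024 ^ M\<close>, dominates the exponent
    \<open>10 * M * 4 ^ M\<close> of \<open>N\<close>.\<close>
  have large: "4 * M * N \<le> 2 ^ (6 * d i)" for i
  proof -
    have "4 * M * N \<le> 2 ^ 2 * 2 ^ M * N" using M_less by (intro mult_mono) auto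
    also have "\<dots> = 2 ^ (2 + M + 10 * M * 4 ^ M)" by (simp add: N_def power_add)
    also have "\<dots> \<le> 2 ^ (6 * d i)"
    proof (rule power_increasing)
      have "M * 4 ^ M \<le> 2 ^ M * 4 ^ M" using M_less by (intro mult_right_mono) auto
      also have "\<dots> = (8::nat) ^ M" by (simp flip: power_mult_distrib)
      finally have "2 + M + 10 * M * 4 ^ M \<le> 2 * 2 ^ M + 10 * 8 ^ M"
        using M_less M by linarith
      also have "\<dots> \<le> 12 * (8::nat) ^ M" using power_mono[of 2 "8::nat" M] by simp
      also have "\<dots> \<le> 128 ^ 1 * 8 ^ M" by simp
      also have "\<dots> \<le> 128 ^ M * 8 ^ M" using M by (intro mult_right_mono power_increasing) auto
      also have "\<dots> = d 0" by (simp add: d_def power_mult flip: power_mult_distrib)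
      also have "\<dots> \<le> 6 * d i" using d0[of i] by simp
      finally show "2 + M + 10 * M * 4 ^ M \<le> 6 * d i" .
    qed simp
    finally show ?thesis .
  qed
  obtain f where f: "\<And>a i. a < N \<Longrightarrow> i < M \<Longrightarrow> f (a, i) \<in> B i"
    "\<And>i v. i < M \<Longrightarrow> card {a. a < N \<and> f (a, i) = v} \<le> 6 * d i"
    "\<And>m W P. 0 < m \<Longrightarrow> m < M \<Longrightarrow> W \<noteq> {} \<Longrightarrow> W \<subseteq> {..<2 * N} \<Longrightarrow>
      card W * d m \<le> 2 * M\<^sup>2 * d (m - 1) * N \<Longrightarrow>
      P \<subseteq> (W \<inter> {..<N}) \<times> {..<m} \<Longrightarrow> f ` P \<subseteq> W \<Longrightarrow> card P < 2 * card W"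
    by (rule random_layers[of N d M B]) (use N d_pos d_mono card_B growth large in \<open>auto simp: B_def\<close>)
  have "layered N M d B f"
  proof
    show "4 * d i \<le> d (Suc i)" for i
    proof -
      have "4 * d i = 2 ^ (2 + 10 * M * 4 ^ i)" by (simp add: d_def power_add)
      also have "\<dots> \<le> d (Suc i)"
        unfolding d_def
      proof (rule power_increasing)
        have "2 * 1 \<le> 10 * M * 4 ^ i" using M by (intro mult_mono) auto
        then show "2 + 10 * M * 4 ^ i \<le> 10 * M * 4 ^ Suc i" by simp
      qed simp
      finally show ?thesis .
    qed
    show "B i \<inter> B j = {}" if "i \<noteq> j" for i j
      using disj[of i j] disj[of j i] that by (cases "i < j") auto
    show "N \<le> v" if "v \<in> B i" for i v using BD[OF that] by simp
  qed (use M N d_pos card_B B_less f in \<open>auto simp: B_def\<close>)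
  then show ?thesis unfolding N_def by blast
qed

section \<open>Iterated logarithms and the choice of \<open>M\<close>\<close>

lemma double_exp_bound:
  assumes "0 < M" "10 * real M \<le> ln (ln x)" "0 < ln x" "0 < x"
  shows "2 * 2 ^ (10 * M * 4 ^ M) \<le> x"
proof -
  have two: "(2::real) \<le> exp 1" using exp_ge_add_one_self[of 1] by simp
  \<comment> \<open>The exponent of \<open>2 * N\<close> is at most \<open>2 ^ (10 * M)\<close>,
    hence at most \<open>exp (10 * M)\<close>, which is at most \<open>ln x\<close>. This is why
    \<open>M\<close> will be a tenth of the double logarithm.\<close>
  have "real M * 4 ^ M \<le> 2 ^ M * 4 ^ M"
    using of_nat_less_two_power[of M, where 'a = real] by (intro mult_right_mono) auto
  also have "\<dots> = (8::real) ^ M" by (simp flip: power_mult_distrib)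
  finally have "1 + 10 * real M * 4 ^ M \<le> 11 * 8 ^ M"
    using one_le_power[of "8::real" M] by linarith
  also have "11 * (8::real) ^ M \<le> 2 ^ (10 * M)"
  proof -
    have "11 * (8::real) ^ M \<le> 128 ^ 1 * 8 ^ M" by simp
    also have "\<dots> \<le> 128 ^ M * 8 ^ M" using assms(1) by (intro mult_right_mono power_increasing) auto
    finally show ?thesis by (simp add: power_mult flip: power_mult_distrib)
  qed
  also have "(2::real) ^ (10 * M) \<le> exp 1 ^ (10 * M)" using two by (intro power_mono) auto
  also have "\<dots> = exp (10 * real M)" by (simp flip: exp_of_nat_mult)
  also have "\<dots> \<le> exp (ln (ln x))" using assms(2) by simp
  also have "\<dots> = ln x" using assms(3) by simp
  finally have le: "1 + 10 * real M * 4 ^ M \<le> ln x" .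
  have "(2::real) * 2 ^ (10 * M * 4 ^ M) = 2 ^ (1 + 10 * M * 4 ^ M)" by simp
  also have "\<dots> \<le> exp 1 ^ (1 + 10 * M * 4 ^ M)" using two by (intro power_mono) auto
  also have "\<dots> = exp (1 + 10 * real M * 4 ^ M)" by (subst exp_of_nat_mult[symmetric]) simp
  also have "\<dots> \<le> exp (ln x)" using le by simp
  also have "\<dots> = x" using assms(4) by simp
  finally show ?thesis .
qed

text \<open>Beyond this point the triple logarithm is at least 1, so dividing by it only decreases;
  a bound by the double logarithm suffices, and monotonicity of the quotient never comes up.\<close>

lemma iterated_ln_bounds:
  fixes x :: real
  assumes "exp (exp (exp 1)) \<le> x"
  shows "0 < ln x" "0 < ln (ln x)" "1 \<le> ln (ln (ln x))"
    "ln (ln x) / ln (ln (ln x)) \<le> ln (ln x)"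
proof -
  have "exp (exp 1) \<le> ln x" using assms by (subst ln_ge_iff) (auto intro: less_le_trans[OF exp_gt_zero])
  moreover from this show x1: "0 < ln x" by (rule less_le_trans[OF exp_gt_zero])
  ultimately have "exp 1 \<le> ln (ln x)" by (subst ln_ge_iff) auto
  moreover from this show x2: "0 < ln (ln x)" by (rule less_le_trans[OF exp_gt_zero])
  ultimately show x3: "1 \<le> ln (ln (ln x))" by (subst ln_ge_iff) auto
  have "ln (ln x) * 1 \<le> ln (ln x) * ln (ln (ln x))" using x2 x3 by (intro mult_left_mono) auto
  then show "ln (ln x) / ln (ln (ln x)) \<le> ln (ln x)" using x3 by (simp add: divide_le_eq)
qed

theorem mainTheorem2:
  shows "\<exists>(c::real) (n0::nat). 0 < c \<and>
    (\<forall>n \<ge> n0. \<exists>G :: nat pair_pre_digraph.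
       pair_graph G \<and> card (pverts G) = n \<and>
       real (degeneracy G) / spectral_degeneracy G
         \<ge> c * (ln (ln (real n)) / ln (ln (ln (real n)))) \<and>
       0 < ln (real (max_degree G)) \<and>
       0 < ln (ln (real (max_degree G))) \<and>
       0 < ln (ln (ln (real (max_degree G)))) \<and>
       real (degeneracy G) / spectral_degeneracy G
         \<ge> c * (ln (ln (real (max_degree G))) / ln (ln (ln (real (max_degree G))))))"
proof -
  \<comment> \<open>\<open>M\<close> will be at least \<open>K\<close>: this gives \<open>M\<close>
    at least 4 and a maximum degree to which \<open>iterated_ln_bounds\<close> applies.\<close>
  define K where "K = 4 + exp (exp (exp (1::real)))"
  have K: "4 \<le> K" "exp (exp (exp 1)) \<le> K" by (auto simp: K_def)
  have "\<exists>G :: nat pair_pre_digraph.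
       pair_graph G \<and> card (pverts G) = n \<and>
       real (degeneracy G) / spectral_degeneracy G
         \<ge> 1 / 11520 * (ln (ln (real n)) / ln (ln (ln (real n)))) \<and>
       0 < ln (real (max_degree G)) \<and>
       0 < ln (ln (real (max_degree G))) \<and>
       0 < ln (ln (ln (real (max_degree G)))) \<and>
       real (degeneracy G) / spectral_degeneracy G
         \<ge> 1 / 11520 * (ln (ln (real (max_degree G))) / ln (ln (ln (real (max_degree G)))))"
    if n: "nat \<lceil>exp (exp (10 * (K + 1)))\<rceil> \<le> n" for n
  proof -
    have n': "exp (exp (10 * (K + 1))) \<le> real n" using n by linarith
    then have n_pos: "0 < real n" by (rule less_le_trans[OF exp_gt_zero])
    have ln_n: "exp (10 * (K + 1)) \<le> ln (real n)" using n' n_pos by (simp add: ln_ge_iff)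
    then have ln_pos: "0 < ln (real n)" by (rule less_le_trans[OF exp_gt_zero])
    have lnln_n: "10 * (K + 1) \<le> ln (ln (real n))" using ln_n ln_pos by (simp add: ln_ge_iff)
    define M where "M = nat \<lfloor>ln (ln (real n)) / 10\<rfloor>"
    have M_le: "real M \<le> ln (ln (real n)) / 10" and M_gt: "ln (ln (real n)) / 10 < real M + 1"
    proof -
      have "0 \<le> ln (ln (real n)) / 10" using lnln_n K by simp
      then show "real M \<le> ln (ln (real n)) / 10" "ln (ln (real n)) / 10 < real M + 1"
        unfolding M_def by linarith+
    qed
    have M_K: "K \<le> real M" using lnln_n M_gt by simp
    then have M4: "4 \<le> M" using K(1) by linarith
    \<comment> \<open>Rounding costs at most a factor 2 on top of the 10, and 20 times 576 is the
      constant 11520.\<close>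
    have M_large: "ln (ln (real n)) \<le> 20 * real M" using M_gt M4 by simp
    have "2 \<le> M" using M4 by simp
    then obtain d B f where "layered (2 ^ (10 * M * 4 ^ M)) M d B f"
      using exists_layered by blast
    then interpret layered "2 ^ (10 * M * 4 ^ M)" M d B f .
    have "real (2 * 2 ^ (10 * M * 4 ^ M)) \<le> real n"
      using double_exp_bound[of M "real n"] M4 M_le ln_pos n_pos by simp
    then have Nn: "2 * 2 ^ (10 * M * 4 ^ M) \<le> n" by (simp only: of_nat_le_iff)
    define G where "G = graph_on n"
    let ?\<Delta> = "real (max_degree G)"
    let ?r = "real (degeneracy G) / spectral_degeneracy G"
    have \<Delta>: "exp (exp (exp 1)) \<le> ?\<Delta>" "?\<Delta> \<le> real n"
      using max_degree_graph_on[OF Nn] M_K K(2) by (auto simp: G_def)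
    note \<Delta>_ln = iterated_ln_bounds[OF \<Delta>(1)]
    note n_ln = iterated_ln_bounds[OF order_trans[OF \<Delta>]]
    have "0 < ?\<Delta>" using \<Delta>(1) by (rule less_le_trans[OF exp_gt_zero])
    then have "ln (ln ?\<Delta>) \<le> ln (ln (real n))"
      using \<Delta>(2) \<Delta>_ln(1) n_ln(1) by (subst ln_le_cancel_iff) auto
    moreover have "1 / 11520 * ln (ln (real n)) \<le> ?r"
      using ratio_graph_on[OF Nn M4] M_large unfolding G_def by linarith
    ultimately have "1 / 11520 * (ln (ln (real n)) / ln (ln (ln (real n)))) \<le> ?r"
      "1 / 11520 * (ln (ln ?\<Delta>) / ln (ln (ln ?\<Delta>))) \<le> ?r"
      using \<Delta>_ln(4) n_ln(4) by linarith+
    moreover have "pair_graph G" "card (pverts G) = n"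
      using pair_graph_graph_on[OF Nn] by (auto simp: G_def graph_on_def)
    moreover have "0 < ln (ln (ln ?\<Delta>))" using \<Delta>_ln(3) by linarith
    ultimately show ?thesis using \<Delta>_ln(1,2) by blast
  qed
  then show ?thesis
    by (intro exI[of _ "1 / 11520"] exI[of _ "nat \<lceil>exp (exp (10 * (K + 1)))\<rceil>"]) auto
qed

end
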